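(* Let $n\ge1$ (with $n\ge2$ if $\gamma=2$), $\gamma\ge2$, $d\ge1$ and $G\in\mathcal{S}_{\mathrm{Disc}}$. Then the process $(\mathcal{M}^n_t(G))_{0\le t\le T}$ defined by $$\mathcal{M}^n_t(G):=\langle\pi^n_t,G_t\rangle-\langle\pi^n_0,G_0\rangle-\int_0^t\langle\pi^n_s,\partial_sG_s\rangle\,ds-\int_0^t\Theta(n)\mathcal{L}_n\big(\langle\pi^n_s,G_s\rangle\big)\,ds$$ is a martingale with respect to the natural filtration $\mathcal{F}_t=\sigma(\eta^n_s:s\in[0,t])$, $t\in[0,T]$. Moreover, for every $t\in[0,T]$, $$\mathbb{E}\big[(\mathcal{M}^n_t(G))^2\big]=\mathbb{E}\Big[\int_0^t\Theta(n)\big[\mathcal{L}_n(\langle\pi^n_s,G_s\rangle^2)-2\langle\pi^n_s,G_s\rangle\,\mathcal{L}_n(\langle\pi^n_s,G_s\rangle)\big]ds\Big].$$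
   Context: Model. Fix $T>0$, $d\ge1$, $\gamma\ge2$, $\alpha>0$, $\beta\ge0$. $|\cdot|$ is the maximum norm, $\hat e_1,\dots,\hat e_d$ is the canonical basis of $\mathbb{R}^d$, $\mathbb{N}=\{0,1,2,\dots\}$. The transition probability $p:\mathbb{Z}^d\to[0,1]$ is $p(\hat x)=\frac{c_\gamma}{d}|\hat x|^{-\gamma-1}$ if $\hat x\ne\hat 0$ and $\hat x=\pm|\hat x|\hat e_j$ for some $j$, and $p(\hat x)=0$ otherwise; $c_\gamma$ is the constant making $p$ a probability. For $\eta\in\Omega=\{0,1\}^{\mathbb{Z}^d}$, $\eta^{\hat x,\hat y}$ is $\eta$ with the values at $\hat x$ and $\hat y$ exchanged. A pair $\{\hat x,\hat y\}$ of distinct sites is a slow bond if one of the sites lies in $\mathbb{Z}^{d-1}\times\{-1,-2,\dots\}$ and the other in $\mathbb{Z}^{d-1}\times\mathbb{N}$. Put $r^n_{\hat x,\hat y}=\alpha n^{-\beta}$ for slow bonds and $r^n_{\hat x,\hat y}=1$ otherwise. The exclusion process has generator, on local functions $f$, $(\mathcal{L}_nf)(\eta)=\frac12\sum_{\hat x,\hat y\in\mathbb{Z}^d}p(\hat y-\hat x)\,r^n_{\hat x,\hat y}\,[f(\eta^{\hat x,\hat y})-f(\eta)]$. Let $\Theta(n)=n^2$ if $\gamma>2$ and $\Theta(n)=n^2/\log n$ if $\gamma=2$. $(\eta^n_t)_{t\in[0,T]}$ is the Markov process with generator $\Theta(n)\mathcal{L}_n$, started from an initial law $\mu_n$ on $\Omega$;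 $\mathbb{E}$ is the corresponding expectation. For $\eta\in\Omega$ and $G:\mathbb{R}^d\to\mathbb{R}$ bounded with compact support, $\langle\pi^n(\eta),G\rangle=n^{-d}\sum_{\hat x\in\mathbb{Z}^d}\eta(\hat x)G(\hat x/n)$ (a local function of $\eta$), and $\langle\pi^n_t,G\rangle=\langle\pi^n(\eta^n_t),G\rangle$. The expression $\mathcal{L}_n(\langle\pi^n_s,G_s\rangle)$ means the function $\mathcal{L}_n\big(\eta\mapsto\langle\pi^n(\eta),G_s\rangle\big)$ evaluated at $\eta^n_s$, with $s$ fixed in $G_s=G(s,\cdot)$; similarly for $\langle\pi^n_s,G_s\rangle^2$. Test functions. $\mathcal{S}_{\mathrm{Dif}}=C^{1,2}_c([0,\infty)\times\mathbb{R}^d)$: functions with compact support in $[0,\infty)\times\mathbb{R}^d$, $C^1$ in time and $C^2$ in space. $\mathcal{S}_{\mathrm{Disc}}$: functions $G=\mathbb{1}_{[0,\infty)\times\mathbb{R}^{d-1}\times(-\infty,0)}G^-+\mathbb{1}_{[0,\infty)\times\mathbb{R}^{d-1}\times[0,\infty)}G^+$ with $G^\pm\in\mathcal{S}_{\mathrm{Dif}}$. *)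

theory Defs
  imports "HOL-Probability.Probability"
begin

section \<open>Configurations and jump rates\<close>

text \<open>
  The lattice is \<open>int ^ 'd\<close>, with dimension \<open>CARD('d)\<close>. Since the index type carries no order,
  the coordinate normal to the barrier (the last one in the usual notation) is an explicit
  parameter \<open>l :: 'd\<close>.
\<close>

type_synonym 'd config = "int ^ 'd \<Rightarrow> bool"

abbreviation config_space :: "('d::finite) config measure" where
  "config_space \<equiv> (\<Pi>\<^sub>M x\<in>UNIV. count_space UNIV)"

definition maxnorm :: "int ^ 'd::finite \<Rightarrow> int" where
  "maxnorm x = Max (range (\<lambda>i. \<bar>x $ i\<bar>))"

definition jump_weight :: "real \<Rightarrow> int ^ 'd::finite \<Rightarrow> real" where
  "jump_weight \<gamma> x =
     (if x \<noteq> 0 \<and> (\<exists>j. x = axis j (maxnorm x) \<or> x = - axis j (maxnorm x))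
      then (1 / real CARD('d)) * real_of_int (maxnorm x) powr (- \<gamma> - 1) else 0)"

text \<open>The constant \<open>c\<^sub>\<gamma>\<close> is the reciprocal of the total weight.\<close>

definition trans_prob :: "real \<Rightarrow> int ^ 'd::finite \<Rightarrow> real" where
  "trans_prob \<gamma> x = (1 / (\<Sum>\<^sub>\<infinity>y\<in>(UNIV :: (int ^ 'd) set). jump_weight \<gamma> y)) * jump_weight \<gamma> x"

definition exchange :: "int ^ 'd \<Rightarrow> int ^ 'd \<Rightarrow> 'd config \<Rightarrow> 'd config" where
  "exchange x y \<eta> = \<eta>(x := \<eta> y, y := \<eta> x)"

definition slow_bond :: "'d \<Rightarrow> int ^ 'd \<Rightarrow> int ^ 'd \<Rightarrow> bool" where
  "slow_bond l x y \<longleftrightarrow> (x $ l < 0 \<and> 0 \<le> y $ l) \<or> (y $ l < 0 \<and> 0 \<le> x $ l)"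

definition bond_rate :: "'d \<Rightarrow> real \<Rightarrow> real \<Rightarrow> nat \<Rightarrow> int ^ 'd \<Rightarrow> int ^ 'd \<Rightarrow> real" where
  "bond_rate l \<alpha> \<beta> n x y = (if slow_bond l x y then \<alpha> * real n powr (- \<beta>) else 1)"

section \<open>Generator and process\<close>

definition local_fun :: "('d config \<Rightarrow> real) \<Rightarrow> bool" where
  "local_fun f \<longleftrightarrow>
     (\<exists>A. finite A \<and> (\<forall>\<eta> \<xi>. (\<forall>x\<in>A. \<eta> x = \<xi> x) \<longrightarrow> f \<eta> = f \<xi>))"

definition excl_gen ::
  "('d::finite) \<Rightarrow> real \<Rightarrow> real \<Rightarrow> real \<Rightarrow> nat \<Rightarrow> ('d config \<Rightarrow> real) \<Rightarrow> 'd config \<Rightarrow> real" where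
  "excl_gen l \<gamma> \<alpha> \<beta> n f \<eta> =
     (1/2) * (\<Sum>\<^sub>\<infinity>(x, y)\<in>UNIV.
        trans_prob \<gamma> (y - x) * bond_rate l \<alpha> \<beta> n x y * (f (exchange x y \<eta>) - f \<eta>))"

definition time_scale :: "real \<Rightarrow> nat \<Rightarrow> real" where
  "time_scale \<gamma> n = (if \<gamma> > 2 then (real n)\<^sup>2 else (real n)\<^sup>2 / ln (real n))"

text \<open>
  Markov semigroups on \<open>C(\<Omega>)\<close>; as \<open>\<Omega>\<close> is compact, \<open>C(\<Omega>)\<close> is the space of bounded continuous
  functions with the uniform norm.
\<close>

definition markov_semigroup ::
  "(real \<Rightarrow> ('a::topological_space \<Rightarrow>\<^sub>C real) \<Rightarrow> ('a \<Rightarrow>\<^sub>C real)) \<Rightarrow> bool" where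
  "markov_semigroup S \<longleftrightarrow>
     (\<forall>t\<ge>0. linear (S t)) \<and>
     (\<forall>f. S 0 f = f) \<and>
     (\<forall>s\<ge>0. \<forall>t\<ge>0. \<forall>f. S (s + t) f = S s (S t f)) \<and>
     (\<forall>t\<ge>0. S t (const_bcontfun 1) = const_bcontfun 1) \<and>
     (\<forall>t\<ge>0. \<forall>f. (\<forall>x. 0 \<le> apply_bcontfun f x) \<longrightarrow> (\<forall>x. 0 \<le> apply_bcontfun (S t f) x)) \<and>
     (\<forall>f. ((\<lambda>t. S t f) \<longlongrightarrow> f) (at_right 0))"

definition generator_graph ::
  "(real \<Rightarrow> ('a::topological_space \<Rightarrow>\<^sub>C real) \<Rightarrow> ('a \<Rightarrow>\<^sub>C real)) \<Rightarrow>
     (('a \<Rightarrow>\<^sub>C real) \<times> ('a \<Rightarrow>\<^sub>C real)) set" where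
  "generator_graph S = {(f, g). ((\<lambda>t. (1 / t) *\<^sub>R (S t f - f)) \<longlongrightarrow> g) (at_right 0)}"

definition excl_pregenerator_graph ::
  "('d::finite) \<Rightarrow> real \<Rightarrow> real \<Rightarrow> real \<Rightarrow> nat \<Rightarrow>
     (('d config \<Rightarrow>\<^sub>C real) \<times> ('d config \<Rightarrow>\<^sub>C real)) set" where
  "excl_pregenerator_graph l \<gamma> \<alpha> \<beta> n =
     {(f, g). local_fun (apply_bcontfun f) \<and>
        (\<forall>\<eta>. apply_bcontfun g \<eta> = time_scale \<gamma> n * excl_gen l \<gamma> \<alpha> \<beta> n (apply_bcontfun f) \<eta>)}"

definition natural_filtration ::
  "'w measure \<Rightarrow> 'a measure \<Rightarrow> (real \<Rightarrow> 'w \<Rightarrow> 'a) \<Rightarrow> real \<Rightarrow> 'w measure" where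
  "natural_filtration M N \<eta> t =
     sigma (space M) (\<Union>s\<in>{0..t}. {\<eta> s -` A \<inter> space M | A. A \<in> sets N})"

definition cadlag_on :: "real \<Rightarrow> (real \<Rightarrow> 'a::topological_space) \<Rightarrow> bool" where
  "cadlag_on T f \<longleftrightarrow>
     (\<forall>t\<in>{0..<T}. (f \<longlongrightarrow> f t) (at_right t)) \<and>
     (\<forall>t\<in>{0<..T}. \<exists>y. (f \<longlongrightarrow> y) (at_left t))"

text \<open>
  The Markov process on \<open>[0,T]\<close> with generator \<open>\<Theta>(n) \<L>\<^sub>n\<close> and initial law \<open>\<mu>\<close>: its semigroup
  is the one generated by the closure in \<open>C(\<Omega>)\<close> of \<open>\<Theta>(n) \<L>\<^sub>n\<close> on local functions. Every
  path is right continuous with left limits (not merely almost every one), so that no completion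
  of the natural filtration is needed.
\<close>

definition exclusion_process ::
  "('d::finite) \<Rightarrow> real \<Rightarrow> real \<Rightarrow> real \<Rightarrow> nat \<Rightarrow> real \<Rightarrow> 'd config measure \<Rightarrow>
     'w measure \<Rightarrow> (real \<Rightarrow> 'w \<Rightarrow> 'd config) \<Rightarrow> bool" where
  "exclusion_process l \<gamma> \<alpha> \<beta> n T \<mu> M \<eta> \<longleftrightarrow>
     prob_space M \<and>
     (\<forall>t\<in>{0..T}. \<eta> t \<in> measurable M config_space) \<and>
     (\<forall>\<omega>\<in>space M. cadlag_on T (\<lambda>t. \<eta> t \<omega>)) \<and>
     distr M config_space (\<eta> 0) = \<mu> \<and>
     (\<exists>S. markov_semigroup S \<and>
          generator_graph S = closure (excl_pregenerator_graph l \<gamma> \<alpha> \<beta> n) \<and>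
          (\<forall>s t f. 0 \<le> s \<and> s \<le> t \<and> t \<le> T \<longrightarrow>
             (AE \<omega> in M.
                real_cond_exp M (natural_filtration M config_space \<eta> s)
                  (\<lambda>\<omega>. apply_bcontfun f (\<eta> t \<omega>)) \<omega>
                = apply_bcontfun (S (t - s) f) (\<eta> s \<omega>))))"

definition martingale_on :: "real \<Rightarrow> 'w measure \<Rightarrow> (real \<Rightarrow> 'w measure) \<Rightarrow> (real \<Rightarrow> 'w \<Rightarrow> real) \<Rightarrow> bool" where
  "martingale_on T M F X \<longleftrightarrow>
     (\<forall>t\<in>{0..T}. subalgebra M (F t) \<and> X t \<in> borel_measurable (F t) \<and> integrable M (X t)) \<and>
     (\<forall>s t. 0 \<le> s \<and> s \<le> t \<and> t \<le> T \<longrightarrow>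
        sets (F s) \<subseteq> sets (F t) \<and> (AE \<omega> in M. real_cond_exp M (F s) (X t) \<omega> = X s \<omega>))"

section \<open>Test functions and empirical measure\<close>

text \<open>
  Functions on \<open>[0,\<infinity>) \<times> \<real>\<^sup>d\<close> are represented by total functions whose values at negative times
  are irrelevant; time derivatives are one-sided at time 0. The maps \<open>D\<close> and \<open>H\<close> below are the
  spatial gradient and Hessian, jointly continuous in time and space.
\<close>

definition S_Dif :: "(real \<Rightarrow> real ^ 'd::finite \<Rightarrow> real) set" where
  "S_Dif = {G.
     continuous_on ({0..} \<times> UNIV) (\<lambda>(s, u). G s u) \<and>
     compact (closure {(s, u). 0 \<le> s \<and> G s u \<noteq> 0}) \<and>
     (\<exists>Gt. continuous_on ({0..} \<times> UNIV) (\<lambda>(s, u). Gt s u) \<and>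
        (\<forall>s\<ge>0. \<forall>u. ((\<lambda>r. G r u) has_real_derivative Gt s u) (at s within {0..}))) \<and>
     (\<exists>(D :: real \<Rightarrow> real ^ 'd \<Rightarrow> real ^ 'd) (H :: real \<Rightarrow> real ^ 'd \<Rightarrow> real ^ 'd ^ 'd).
        continuous_on ({0..} \<times> UNIV) (\<lambda>(s, u). D s u) \<and>
        continuous_on ({0..} \<times> UNIV) (\<lambda>(s, u). H s u) \<and>
        (\<forall>s\<ge>0. \<forall>u. (G s has_derivative (\<lambda>h. D s u \<bullet> h)) (at u) \<and>
                     (D s has_derivative (\<lambda>h. H s u *v h)) (at u)))}"

definition S_Disc :: "'d::finite \<Rightarrow> (real \<Rightarrow> real ^ 'd \<Rightarrow> real) set" where
  "S_Disc l = {G. \<exists>Gm\<in>S_Dif. \<exists>Gp\<in>S_Dif. \<forall>s\<ge>0. \<forall>u.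
     G s u = indicator {v. v $ l < 0} u * Gm s u + indicator {v. 0 \<le> v $ l} u * Gp s u}"

definition time_deriv :: "(real \<Rightarrow> 'a \<Rightarrow> real) \<Rightarrow> real \<Rightarrow> 'a \<Rightarrow> real" where
  "time_deriv G s u = vector_derivative (\<lambda>r. G r u) (at s within {0..})"

definition emp :: "nat \<Rightarrow> 'd::finite config \<Rightarrow> (real ^ 'd \<Rightarrow> real) \<Rightarrow> real" where
  "emp n \<eta> g =
     (1 / real n ^ CARD('d)) *
       (\<Sum>\<^sub>\<infinity>x\<in>UNIV. of_bool (\<eta> x) * g (\<chi> i. real_of_int (x $ i) / real n))"

definition dynkin_mart ::
  "('d::finite) \<Rightarrow> real \<Rightarrow> real \<Rightarrow> real \<Rightarrow> nat \<Rightarrow> (real \<Rightarrow> 'w \<Rightarrow> 'd config) \<Rightarrow>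
     (real \<Rightarrow> real ^ 'd \<Rightarrow> real) \<Rightarrow> real \<Rightarrow> 'w \<Rightarrow> real" where
  "dynkin_mart l \<gamma> \<alpha> \<beta> n \<eta> G t \<omega> =
     emp n (\<eta> t \<omega>) (G t) - emp n (\<eta> 0 \<omega>) (G 0)
     - (LBINT s:{0..t}. emp n (\<eta> s \<omega>) (time_deriv G s))
     - (LBINT s:{0..t}. time_scale \<gamma> n *
          excl_gen l \<gamma> \<alpha> \<beta> n (\<lambda>\<xi>. emp n \<xi> (G s)) (\<eta> s \<omega>))"

definition carre_du_champ_integral ::
  "('d::finite) \<Rightarrow> real \<Rightarrow> real \<Rightarrow> real \<Rightarrow> nat \<Rightarrow> (real \<Rightarrow> 'w \<Rightarrow> 'd config) \<Rightarrow>
     (real \<Rightarrow> real ^ 'd \<Rightarrow> real) \<Rightarrow> real \<Rightarrow> 'w \<Rightarrow> real" where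
  "carre_du_champ_integral l \<gamma> \<alpha> \<beta> n \<eta> G t \<omega> =
     (LBINT s:{0..t}. time_scale \<gamma> n *
        (excl_gen l \<gamma> \<alpha> \<beta> n (\<lambda>\<xi>. (emp n \<xi> (G s))\<^sup>2) (\<eta> s \<omega>)
         - 2 * emp n (\<eta> s \<omega>) (G s) * excl_gen l \<gamma> \<alpha> \<beta> n (\<lambda>\<xi>. emp n \<xi> (G s)) (\<eta> s \<omega>)))"

end

(* Restricted to the finitely many sites x/n in the support of G, the empirical
   measure is a finite sum of C^1 functions of time multiplied by occupation variables, and these
   and their pairwise products are local, hence in the domain of the generator. For
   F(t) = sum_i g_i(t) h_i with h_i in the domain, conditioning on the past turns
   E[Z F(r, X_r)] into a C^1 function of r through the semigroup, and the fundamental theorem of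
   calculus yields the martingale property. The same applied to F^2 gives a second martingale;
   the formula for the second moment follows from the two by algebra, Fubini and the identity
   int_0^t c_s (int_0^s c_r dr) ds = (int_0^t c_s ds)^2 / 2. Right continuity of the paths
   supplies all joint measurability that Fubini requires. *)

theory Submission
  imports Defs
begin

section \<open>Bounded right-continuous adapted processes\<close>

text \<open>The filtration is not completed, so a time integral must be measurable for
  \<open>F t\<close> itself and not merely up to null sets. Hence limits and bounds are required at
  every \<omega>, and joint measurability is proved over \<open>F t\<close> rather than only over
  \<open>M\<close>. The generator acts on functions without a time variable. Time is therefore
  confined to the real coefficients \<open>g i\<close>, and the product rule takes the place of a
  semigroup in space and time. No stochastic integration enters. A process is its initial value plus
  a martingale plus a time integral; after squaring, the only difficult term is the product of
  martingale and integral, and it yields to testing the martingale against bounded variables of the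
  past. The time derivatives leave no trace in the second moment: differentiation in time obeys the
  Leibniz rule, so its contributions to the drift of the square and to twice the process times its
  own drift cancel. The generator does not obey that rule, and its defect is the integrand of the
  formula.\<close>

locale bounded_filtration = prob_space M for M :: "'w measure" +
  fixes T :: real and F :: "real \<Rightarrow> 'w measure"
  assumes subalg: "t \<in> {0..T} \<Longrightarrow> subalgebra M (F t)"
    and filt_mono: "0 \<le> s \<Longrightarrow> s \<le> t \<Longrightarrow> t \<le> T \<Longrightarrow> sets (F s) \<subseteq> sets (F t)"
begin

text \<open>Right limits are demanded only on [0, T), since nothing is known about a process after
  T. The bound is uniform in time and \<omega>, which makes the class closed under products and time
  integrals; every term of the second moment computation then stays inside it.\<close>

definition rc_process :: "(real \<Rightarrow> 'w \<Rightarrow> real) \<Rightarrow> bool" where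
  "rc_process Y \<longleftrightarrow>
     (\<forall>t\<in>{0..T}. Y t \<in> borel_measurable (F t)) \<and>
     (\<forall>\<omega>\<in>space M. \<forall>t\<in>{0..<T}. ((\<lambda>s. Y s \<omega>) \<longlongrightarrow> Y t \<omega>) (at_right t)) \<and>
     (\<exists>C\<ge>0. \<forall>t\<in>{0..T}. \<forall>\<omega>\<in>space M. \<bar>Y t \<omega>\<bar> \<le> C)"

lemma space_filt [simp]: "t \<in> {0..T} \<Longrightarrow> space (F t) = space M"
  using subalg by (simp add: subalgebra_def)

lemma measurable_filt_mono:
  assumes "f \<in> measurable (F s) N" "0 \<le> s" "s \<le> t" "t \<le> T"
  shows "f \<in> measurable (F t) N"
proof -
  have "subalgebra (F t) (F s)"
    using assms filt_mono[of s t] space_filt[of s] space_filt[of t] by (auto simp: subalgebra_def)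
  then show ?thesis using assms(1) by (rule measurable_from_subalg)
qed

lemma sigma_finite_filt: "t \<in> {0..T} \<Longrightarrow> sigma_finite_subalgebra M (F t)"
  by (intro finite_measure_subalgebra_is_sigma_finite finite_measure_subalgebra.intro
      finite_measure_subalgebra_axioms.intro subalg) unfold_locales

lemma rc_processD:
  assumes "rc_process Y"
  shows rc_adapted: "t \<in> {0..T} \<Longrightarrow> Y t \<in> borel_measurable (F t)"
    and rc_right_cont: "\<omega> \<in> space M \<Longrightarrow> t \<in> {0..<T} \<Longrightarrow> ((\<lambda>s. Y s \<omega>) \<longlongrightarrow> Y t \<omega>) (at_right t)"
  using assms by (auto simp: rc_process_def)

definition rc_bound :: "(real \<Rightarrow> 'w \<Rightarrow> real) \<Rightarrow> real" where
  "rc_bound Y = (SOME C. C \<ge> 0 \<and> (\<forall>t\<in>{0..T}. \<forall>\<omega>\<in>space M. \<bar>Y t \<omega>\<bar> \<le> C))"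

lemma
  assumes "rc_process Y"
  shows rc_bound_nonneg: "rc_bound Y \<ge> 0"
    and rc_bound: "t \<in> {0..T} \<Longrightarrow> \<omega> \<in> space M \<Longrightarrow> \<bar>Y t \<omega>\<bar> \<le> rc_bound Y"
proof -
  have "\<exists>C. C \<ge> 0 \<and> (\<forall>t\<in>{0..T}. \<forall>\<omega>\<in>space M. \<bar>Y t \<omega>\<bar> \<le> C)"
    using assms by (auto simp: rc_process_def)
  from someI_ex[OF this] show "rc_bound Y \<ge> 0"
    "t \<in> {0..T} \<Longrightarrow> \<omega> \<in> space M \<Longrightarrow> \<bar>Y t \<omega>\<bar> \<le> rc_bound Y"
    unfolding rc_bound_def by blast+
qed

lemma rc_measurable:
  assumes "rc_process Y" "t \<in> {0..T}"
  shows "Y t \<in> borel_measurable M"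
  using measurable_from_subalg[OF subalg rc_adapted] assms by blast

lemma rc_integrable:
  assumes "rc_process Y" "t \<in> {0..T}"
  shows "integrable M (Y t)"
proof -
  define C where "C = rc_bound Y"
  note C = rc_bound_nonneg[OF assms(1), folded C_def] rc_bound[OF assms(1), folded C_def]
  show ?thesis
  proof (rule integrable_const_bound[where B = C])
    show "AE \<omega> in M. norm (Y t \<omega>) \<le> C"
      using C assms(2) by (intro AE_I2) simp
  qed (rule rc_measurable[OF assms])
qed

lemma rc_process_add:
  assumes "rc_process Y" "rc_process Z"
  shows "rc_process (\<lambda>t \<omega>. Y t \<omega> + Z t \<omega>)"
proof -
  define C where "C = rc_bound Y"
  note C = rc_bound_nonneg[OF assms(1), folded C_def] rc_bound[OF assms(1), folded C_def]
  define D where "D = rc_bound Z"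
  note D = rc_bound_nonneg[OF assms(2), folded D_def] rc_bound[OF assms(2), folded D_def]
  have "\<bar>Y t \<omega> + Z t \<omega>\<bar> \<le> C + D" if "t \<in> {0..T}" "\<omega> \<in> space M" for t \<omega>
    using C(2)[OF that] D(2)[OF that] by linarith
  then have "\<exists>B\<ge>0. \<forall>t\<in>{0..T}. \<forall>\<omega>\<in>space M. \<bar>Y t \<omega> + Z t \<omega>\<bar> \<le> B"
    using C(1) D(1) by (intro exI[of _ "C + D"]) auto
  then show ?thesis
    using assms rc_processD[OF assms(1)] rc_processD[OF assms(2)]
    unfolding rc_process_def by (auto intro!: tendsto_intros borel_measurable_add)
qed

lemma rc_process_mult:
  assumes "rc_process Y" "rc_process Z"
  shows "rc_process (\<lambda>t \<omega>. Y t \<omega> * Z t \<omega>)"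
proof -
  define C where "C = rc_bound Y"
  note C = rc_bound_nonneg[OF assms(1), folded C_def] rc_bound[OF assms(1), folded C_def]
  define D where "D = rc_bound Z"
  note D = rc_bound_nonneg[OF assms(2), folded D_def] rc_bound[OF assms(2), folded D_def]
  have "\<bar>Y t \<omega> * Z t \<omega>\<bar> \<le> C * D" if "t \<in> {0..T}" "\<omega> \<in> space M" for t \<omega>
    using C(2)[OF that] D(2)[OF that] by (simp add: abs_mult mult_mono' )
  then have "\<exists>B\<ge>0. \<forall>t\<in>{0..T}. \<forall>\<omega>\<in>space M. \<bar>Y t \<omega> * Z t \<omega>\<bar> \<le> B"
    using C(1) D(1) by (intro exI[of _ "C * D"]) auto
  then show ?thesis
    using assms rc_processD[OF assms(1)] rc_processD[OF assms(2)]
    unfolding rc_process_def by (auto intro!: tendsto_intros borel_measurable_times)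
qed

lemma rc_process_deterministic:
  assumes "continuous_on {0..T} g"
  shows "rc_process (\<lambda>t \<omega>. g t)"
proof -
  have "bounded (g ` {0..T})"
    by (intro compact_imp_bounded compact_continuous_image assms compact_Icc)
  then obtain C where "C > 0" "\<forall>x\<in>g ` {0..T}. norm x \<le> C"
    unfolding bounded_pos by blast
  then have "\<exists>B\<ge>0. \<forall>t\<in>{0..T}. \<forall>\<omega>\<in>space M. \<bar>g t\<bar> \<le> B"
    by (intro exI[of _ C]) simp
  moreover have "(g \<longlongrightarrow> g t) (at_right t)" if "t \<in> {0..<T}" for t
  proof -
    have "(g \<longlongrightarrow> g t) (at t within {0..T})"
      using assms that by (auto simp: continuous_on_def)
    moreover have "at_right t = at t within {t<..<T}"
      using that by (intro at_within_nhd[of _ "{..<T}"]) auto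
    moreover have "{t<..<T} \<subseteq> {0..T}" using that by auto
    ultimately show ?thesis
      by (metis tendsto_within_subset)
  qed
  ultimately show ?thesis by (auto simp: rc_process_def)
qed

lemma rc_process_const: "rc_process (\<lambda>t \<omega>. c)"
  by (rule rc_process_deterministic) auto

lemma rc_process_initial:
  assumes "rc_process Y" "T \<ge> 0"
  shows "rc_process (\<lambda>t. Y 0)"
proof -
  define C where "C = rc_bound Y"
  note C = rc_bound_nonneg[OF assms(1), folded C_def] rc_bound[OF assms(1), folded C_def]
  then show ?thesis
    using assms rc_adapted[OF assms(1), of 0] measurable_filt_mono[of "Y 0" 0]
    unfolding rc_process_def by auto
qed

lemma rc_process_cmult: "rc_process Y \<Longrightarrow> rc_process (\<lambda>t \<omega>. c * Y t \<omega>)"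
  by (rule rc_process_mult[OF rc_process_const])

lemma rc_process_diff:
  "rc_process Y \<Longrightarrow> rc_process Z \<Longrightarrow> rc_process (\<lambda>t \<omega>. Y t \<omega> - Z t \<omega>)"
  using rc_process_add[of Y "\<lambda>t \<omega>. (-1) * Z t \<omega>"] rc_process_cmult[of Z "-1"] by simp

lemma rc_process_sum:
  assumes "\<And>i. i \<in> I \<Longrightarrow> rc_process (Y i)"
  shows "rc_process (\<lambda>t \<omega>. \<Sum>i\<in>I. Y i t \<omega>)"
proof (cases "finite I")
  case True
  then show ?thesis using assms
    by (induction I) (auto intro: rc_process_const rc_process_add)
qed (auto intro: rc_process_const)

text \<open>Sampling \<open>Y\<close> at the next point of a grid of mesh \<open>1 / (k + 1)\<close> gives jointly measurable
  processes, which converge to \<open>Y\<close> by right continuity.\<close>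

lemma rc_jointly_measurable:
  assumes "rc_process Y" "t \<in> {0..T}"
  shows "(\<lambda>(\<omega>, s). indicator {0..t} s * Y s \<omega>) \<in> borel_measurable (F t \<Otimes>\<^sub>M lborel)"
proof -
  \<comment> \<open>The cap at \<open>t\<close> prevents the next grid point from looking into the
    future, and the floor at 0 deals with negative \<open>j\<close>: every sampled variable is
    measurable for \<open>F t\<close>.\<close>
  define \<tau> where "\<tau> = (\<lambda>k (j::int). max 0 (min t (real_of_int j / (real k + 1))))"
  define J where "J = (\<lambda>k s. \<lceil>s * (real k + 1)\<rceil>)"
  \<comment> \<open>For a fixed integer \<open>j\<close> the sampled variable does not depend on
    \<open>s\<close>; the index \<open>J k s\<close> selects among countably many such
    variables.\<close>
  have meas: "(\<lambda>(\<omega>, s). indicator {0..t} s * Y (\<tau> k (J k s)) \<omega>)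
      \<in> borel_measurable (F t \<Otimes>\<^sub>M lborel)" for k
  proof -
    have 1: "(\<lambda>p. indicator {0..t} (snd p) * Y (\<tau> k j) (fst p)) \<in> borel_measurable (F t \<Otimes>\<^sub>M lborel)" for j
    proof -
      have "0 \<le> \<tau> k j" "\<tau> k j \<le> t" using assms by (auto simp: \<tau>_def)
      then have [measurable]: "Y (\<tau> k j) \<in> borel_measurable (F t)"
        using assms by (intro measurable_filt_mono[OF rc_adapted[OF assms(1)]]) auto
      show ?thesis by measurable
    qed
    have 2: "(\<lambda>p. J k (snd p)) \<in> measurable (F t \<Otimes>\<^sub>M lborel) (count_space UNIV)"
      unfolding J_def by measurable
    show ?thesis
      using measurable_compose_countable[OF 1 2] by (simp add: case_prod_beta')
  qed
  have lim: "(\<lambda>k. indicator {0..t} s * Y (\<tau> k (J k s)) \<omega>) \<longlonglongrightarrow> indicator {0..t} s * Y s \<omega>"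
    if "\<omega> \<in> space M" for \<omega> s
  proof (cases "s \<in> {0..t}")
    case True
    have ge: "s \<le> real_of_int (J k s) / (real k + 1)" for k
      by (simp add: J_def pos_le_divide_eq)
    have le: "real_of_int (J k s) / (real k + 1) \<le> s + 1 / (real k + 1)" for k
    proof -
      have "real_of_int (J k s) \<le> s * (real k + 1) + 1"
        unfolding J_def by linarith
      then have "real_of_int (J k s) / (real k + 1) \<le> (s * (real k + 1) + 1) / (real k + 1)"
        by (intro divide_right_mono) auto
      also have "\<dots> = s + 1 / (real k + 1)"
        using add_divide_distrib[of "s * (real k + 1)" 1 "real k + 1"] of_nat_0_le_iff[of k]
        by (metis add_nonneg_pos less_irrefl nonzero_mult_div_cancel_right zero_less_one)
      finally show ?thesis .
    qed
    have "(\<lambda>k. Y (\<tau> k (J k s)) \<omega>) \<longlonglongrightarrow> Y s \<omega>"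
    proof (cases "s = t")
      \<comment> \<open>At the right end the cap returns \<open>t\<close> exactly. This settles
        \<open>t = T\<close>, where no right limit is available.\<close>
      case True
      then have "\<tau> k (J k s) = s" for k
        using ge[of k] \<open>s \<in> {0..t}\<close> by (auto simp: \<tau>_def)
      then show ?thesis by simp
    next
      case False
      then have s: "s \<in> {0..<T}" using True assms by auto
      have "((\<lambda>s. Y s \<omega>) \<longlongrightarrow> Y s \<omega>) (at s within {s<..})"
        using rc_right_cont[OF assms(1) that s] by simp
      \<comment> \<open>The sampled times may coincide with \<open>s\<close>, so the punctured right
        limit has to be turned into continuity within \<open>{s..}\<close>.\<close>
      then have "((\<lambda>s. Y s \<omega>) \<longlongrightarrow> Y s \<omega>) (at s within {s..})"
        using at_within_Ici_at_right by metis
      then have "continuous (at s within {s..}) (\<lambda>s. Y s \<omega>)"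
        by (simp add: continuous_within)
      moreover have "\<tau> k (J k s) \<in> {s..}" for k
        using ge[of k] True by (auto simp: \<tau>_def)
      moreover have "(\<lambda>k. \<tau> k (J k s)) \<longlonglongrightarrow> s"
      proof (rule tendsto_sandwich[of "\<lambda>_. s" _ _ "\<lambda>k. s + 1 / (real k + 1)"])
        show "(\<lambda>k. s + 1 / (real k + 1)) \<longlonglongrightarrow> s"
          using tendsto_add[OF tendsto_const LIMSEQ_inverse_real_of_nat, of s]
          by (simp add: inverse_eq_divide add.commute)
        show "\<forall>\<^sub>F k in sequentially. s \<le> \<tau> k (J k s)"
          using ge True by (intro always_eventually allI) (simp add: \<tau>_def le_max_iff_disj)
        show "\<forall>\<^sub>F k in sequentially. \<tau> k (J k s) \<le> s + 1 / (real k + 1)"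
        proof (intro always_eventually allI)
          fix k
          have "0 \<le> s + 1 / (real k + 1)" using True by auto
          then show "\<tau> k (J k s) \<le> s + 1 / (real k + 1)"
            using le[of k] by (simp add: \<tau>_def min_le_iff_disj)
        qed
      qed auto
      ultimately show ?thesis by (rule continuous_within_tendsto_compose')
    qed
    then show ?thesis by (intro tendsto_mult tendsto_const)
  qed auto
  show ?thesis
    by (rule borel_measurable_LIMSEQ_real[OF _ meas])
      (use lim assms in \<open>auto simp: space_pair_measure\<close>)
qed

end

section \<open>Time integrals of processes: path regularity, Fubini, and the square of an
  integral\<close>

text \<open>The squared integral is the integral of \<open>f s * f r\<close> over the plane. The
  diagonal cuts the plane into two triangles, which contribute equally by symmetry of the
  integrand.\<close>

lemma lborel_triangle_integral:
  fixes f :: "real \<Rightarrow> real"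
  assumes f: "integrable lborel f"
  shows "(\<integral>s. f s * (\<integral>r. indicator {..s} r * f r \<partial>lborel) \<partial>lborel) = (\<integral>s. f s \<partial>lborel)\<^sup>2 / 2"
proof -
  define K where "K = (\<integral>s. (\<integral>r. f s * (indicator {..s} r * f r) \<partial>lborel) \<partial>lborel)"
  have [measurable]: "f \<in> borel_measurable borel"
    using borel_measurable_integrable[OF f] by simp
  have ff: "integrable (lborel \<Otimes>\<^sub>M lborel) (\<lambda>(s, r). f s * f r)"
    using f by (intro lborel_pair.Fubini_integrable) (auto simp: abs_mult)
  \<comment> \<open>Written as comparisons of \<open>r\<close> and \<open>s\<close>, the indicators
    are visibly measurable in both variables together.\<close>
  have ind: "indicator {..s} r = (if r \<le> s then 1 else 0 :: real)"
    "indicator {s<..} r = (if s < r then 1 else 0 :: real)" for s r :: real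
    by (simp_all add: indicator_def)
  have tri: "integrable (lborel \<Otimes>\<^sub>M lborel) (\<lambda>(s, r). f s * (indicator {..s} r * f r))"
  proof (rule Bochner_Integration.integrable_bound[OF ff])
    show "(\<lambda>(s, r). f s * (indicator {..s} r * f r)) \<in> borel_measurable (lborel \<Otimes>\<^sub>M lborel)"
      unfolding ind by measurable
  qed (auto simp: abs_mult split: split_indicator intro!: AE_I2)
  have tri': "integrable (lborel \<Otimes>\<^sub>M lborel) (\<lambda>(s, r). f s * (indicator {s<..} r * f r))"
  proof (rule Bochner_Integration.integrable_bound[OF ff])
    show "(\<lambda>(s, r). f s * (indicator {s<..} r * f r)) \<in> borel_measurable (lborel \<Otimes>\<^sub>M lborel)"
      unfolding ind by measurable
  qed (auto simp: abs_mult split: split_indicator intro!: AE_I2)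
  have "(\<integral>s. f s \<partial>lborel)\<^sup>2 = (\<integral>s. (\<integral>r. f s * f r \<partial>lborel) \<partial>lborel)"
    by (simp add: power2_eq_square)
  also have "\<dots> = (\<integral>p. (case p of (s, r) \<Rightarrow> f s * f r) \<partial>(lborel \<Otimes>\<^sub>M lborel))"
    by (rule lborel_pair.integral_fst[OF ff])
  also have "\<dots> = (\<integral>p. (case p of (s, r) \<Rightarrow> f s * (indicator {..s} r * f r)) +
      (case p of (s, r) \<Rightarrow> f s * (indicator {s<..} r * f r)) \<partial>(lborel \<Otimes>\<^sub>M lborel))"
    by (intro Bochner_Integration.integral_cong) (auto split: split_indicator)
  also have "\<dots> = (\<integral>p. (case p of (s, r) \<Rightarrow> f s * (indicator {..s} r * f r)) \<partial>(lborel \<Otimes>\<^sub>M lborel)) +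
      (\<integral>p. (case p of (s, r) \<Rightarrow> f s * (indicator {s<..} r * f r)) \<partial>(lborel \<Otimes>\<^sub>M lborel))"
    by (rule Bochner_Integration.integral_add[OF tri tri'])
  also have "(\<integral>p. (case p of (s, r) \<Rightarrow> f s * (indicator {..s} r * f r)) \<partial>(lborel \<Otimes>\<^sub>M lborel)) = K"
    unfolding K_def by (rule lborel_pair.integral_fst[OF tri, symmetric])
  also have "(\<integral>p. (case p of (s, r) \<Rightarrow> f s * (indicator {s<..} r * f r)) \<partial>(lborel \<Otimes>\<^sub>M lborel))
      = (\<integral>r. (\<integral>s. f s * (indicator {s<..} r * f r) \<partial>lborel) \<partial>lborel)"
    by (rule lborel_pair.integral_snd[OF tri', symmetric])
  \<comment> \<open>With the two variable names interchanged, the upper triangle becomes the lower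
    one without the diagonal, whose sections are single points.\<close>
  also have "\<dots> = K"
    unfolding K_def
  proof (rule Bochner_Integration.integral_cong[OF refl], rule integral_cong_AE)
    fix s :: real
    show "AE r in lborel. f r * (indicator {r<..} s * f s) = f s * (indicator {..s} r * f r)"
      using AE_lborel_singleton[of s] by eventually_elim (auto split: split_indicator)
    have "(\<lambda>r. f r * (indicator {..<s} r * f s)) \<in> borel_measurable lborel" by measurable
    also have "(\<lambda>r. f r * (indicator {..<s} r * f s)) = (\<lambda>r. f r * (indicator {r<..} s * f s))"
      by (auto split: split_indicator)
    finally show "(\<lambda>r. f r * (indicator {r<..} s * f s)) \<in> borel_measurable lborel" .
  qed measurable
  finally show ?thesis by (simp add: K_def)
qed

lemma set_integral_lborel_singleton: "(LBINT s:{a::real}. f s :: real) = 0"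
  unfolding set_lebesgue_integral_def
  by (rule integral_eq_zero_AE) (use AE_lborel_singleton[of a] in eventually_elim, auto)

context bounded_filtration
begin

lemma rc_path_integrable:
  assumes "rc_process Y" "t \<in> {0..T}" "\<omega> \<in> space M"
  shows "set_integrable lborel {0..t} (\<lambda>s. Y s \<omega>)"
proof -
  define C where "C = rc_bound Y"
  note C = rc_bound_nonneg[OF assms(1), folded C_def] rc_bound[OF assms(1), folded C_def]
  have meas: "(\<lambda>s. indicator {0..t} s * Y s \<omega>) \<in> borel_measurable lborel"
    using measurable_Pair2[OF rc_jointly_measurable[OF assms(1,2)], of \<omega>] assms(2,3) by simp
  have int: "integrable lborel (\<lambda>s. indicator {0..t} s * C)"
    using assms(2) by simp
  have "AE s in lborel. norm (indicator {0..t} s * Y s \<omega>) \<le> norm (indicator {0..t} s * C)"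
  proof (intro AE_I2)
    fix s
    show "norm (indicator {0..t} s * Y s \<omega>) \<le> norm (indicator {0..t} s * C)"
      using C(2)[of s \<omega>] assms(2,3) by (cases "s \<in> {0..t}") auto
  qed
  from Bochner_Integration.integrable_bound[OF int meas this] show ?thesis
    unfolding set_integrable_def real_scaleR_def .
qed

text \<open>Joint measurability over \<open>F t\<close> makes the integral up to \<open>t\<close>
  adapted. A bound C for the integrand makes the paths Lipschitz with constant C, and this gives
  both right continuity and boundedness.\<close>

lemma rc_process_integral:
  assumes "rc_process Y"
  shows "rc_process (\<lambda>t \<omega>. LBINT s:{0..t}. Y s \<omega>)"
proof -
  define C where "C = rc_bound Y"
  note C = rc_bound_nonneg[OF assms(1), folded C_def] rc_bound[OF assms(1), folded C_def]
  have incr: "\<bar>(LBINT s:{0..v}. Y s \<omega>) - (LBINT s:{0..u}. Y s \<omega>)\<bar> \<le> C * (v - u)"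
    if "0 \<le> u" "u \<le> v" "v \<le> T" "\<omega> \<in> space M" for u v \<omega>
  proof -
    have int: "integrable lborel (\<lambda>s. indicator {0..w} s * Y s \<omega>)" if "w \<in> {0..T}" for w
      using rc_path_integrable[OF assms that \<open>\<omega> \<in> space M\<close>] by (simp add: set_integrable_def)
    have "(LBINT s:{0..v}. Y s \<omega>) - (LBINT s:{0..u}. Y s \<omega>)
        = (\<integral>s. indicator {0..v} s * Y s \<omega> - indicator {0..u} s * Y s \<omega> \<partial>lborel)"
      using int[of u] int[of v] that by (simp add: set_lebesgue_integral_def)
    also have "\<bar>\<dots>\<bar> \<le> (\<integral>s. C * indicator {u..v} s \<partial>lborel)"
    proof (rule Bochner_Integration.integral_abs_bound_integral)
      show "\<bar>indicator {0..v} s * Y s \<omega> - indicator {0..u} s * Y s \<omega>\<bar> \<le> C * indicator {u..v} s" for s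
        using that C(1) C(2)[of s \<omega>] by (auto split: split_indicator)
    qed (use that int[of u] int[of v] in auto)
    also have "\<dots> = C * (v - u)" using that by simp
    finally show ?thesis .
  qed
  have "(\<lambda>\<omega>. LBINT s:{0..t}. Y s \<omega>) \<in> borel_measurable (F t)" if "t \<in> {0..T}" for t
    using lborel.borel_measurable_lebesgue_integral[of "\<lambda>\<omega> s. indicator {0..t} s * Y s \<omega>" "F t"]
      rc_jointly_measurable[OF assms that] by (simp add: set_lebesgue_integral_def)
  moreover have "((\<lambda>s. LBINT r:{0..s}. Y r \<omega>) \<longlongrightarrow> (LBINT r:{0..t}. Y r \<omega>)) (at_right t)"
    if "\<omega> \<in> space M" "t \<in> {0..<T}" for \<omega> t
  proof -
    have "((\<lambda>s. C * (s - t)) \<longlongrightarrow> C * (t - t)) (at_right t)"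
      by (intro tendsto_intros)
    then have lim: "((\<lambda>s. C * (s - t)) \<longlongrightarrow> 0) (at_right t)" by simp
    have "\<forall>\<^sub>F s in at_right t. s < T"
      using that by (intro eventually_at_rightI[of t T]) auto
    then have "\<forall>\<^sub>F s in at_right t.
        norm ((LBINT r:{0..s}. Y r \<omega>) - (LBINT r:{0..t}. Y r \<omega>)) \<le> C * (s - t)"
      using eventually_at_right_less[of t]
      by eventually_elim (use incr that in auto)
    from Lim_null_comparison[OF this lim] show ?thesis
      by (simp add: LIM_zero_iff)
  qed
  moreover have "\<bar>LBINT s:{0..t}. Y s \<omega>\<bar> \<le> C * T" if "t \<in> {0..T}" "\<omega> \<in> space M" for t \<omega>
  proof -
    have "\<bar>LBINT s:{0..t}. Y s \<omega>\<bar> \<le> C * t"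
      using incr[of 0 t \<omega>] that by (simp add: set_integral_lborel_singleton)
    also have "\<dots> \<le> C * T" using that C by (intro mult_left_mono) auto
    finally show ?thesis .
  qed
  \<comment> \<open>The locale allows negative \<open>T\<close>; the absolute value keeps the bound
    nonnegative in that vacuous case.\<close>
  then have "\<bar>LBINT s:{0..t}. Y s \<omega>\<bar> \<le> \<bar>C * T\<bar>" if "t \<in> {0..T}" "\<omega> \<in> space M" for t \<omega>
    using that by (meson abs_ge_self order_trans)
  then have "\<exists>B\<ge>0. \<forall>t\<in>{0..T}. \<forall>\<omega>\<in>space M. \<bar>LBINT s:{0..t}. Y s \<omega>\<bar> \<le> B"
    by (intro exI[of _ "\<bar>C * T\<bar>"]) simp
  ultimately show ?thesis
    unfolding rc_process_def by blast
qed

lemma rc_process_shifted_integral: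
  assumes "rc_process U" "rc_process Y" "T \<ge> 0"
  shows "rc_process (\<lambda>t \<omega>. U t \<omega> - U 0 \<omega> - (LBINT s:{0..t}. Y s \<omega>))"
  by (intro rc_process_diff rc_process_integral rc_process_initial assms)

lemma rc_mult_integrable:
  assumes Y: "rc_process Y" and t: "t \<in> {0..T}"
    and Z: "Z \<in> borel_measurable M" "\<And>\<omega>. \<omega> \<in> space M \<Longrightarrow> \<bar>Z \<omega>\<bar> \<le> D"
  shows "integrable M (\<lambda>\<omega>. Z \<omega> * Y t \<omega>)"
proof (rule Bochner_Integration.integrable_bound[OF integrable_mult_right[of D]])
  show "integrable M (Y t)" by (rule rc_integrable[OF Y t])
  show "AE \<omega> in M. norm (Z \<omega> * Y t \<omega>) \<le> norm (D * Y t \<omega>)"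
    using Z(2) by (intro AE_I2) (force simp: abs_mult intro!: mult_right_mono)
qed (intro borel_measurable_times Z(1) rc_measurable[OF Y t])

text \<open>The integrand is bounded and lives on \<open>space M \<times> {0..t}\<close>, a set of
  finite product measure. This is the hypothesis for Fubini below.\<close>

lemma rc_product_integrable:
  assumes Y: "rc_process Y" and t: "t \<in> {0..T}"
    and Z: "Z \<in> borel_measurable M" "\<And>\<omega>. \<omega> \<in> space M \<Longrightarrow> \<bar>Z \<omega>\<bar> \<le> D"
  shows "integrable (M \<Otimes>\<^sub>M lborel) (\<lambda>(\<omega>, s). Z \<omega> * (indicator {0..t} s * Y s \<omega>))"
proof -
  define C where "C = rc_bound Y"
  note C = rc_bound_nonneg[OF Y, folded C_def] rc_bound[OF Y, folded C_def]
  let ?f = "\<lambda>\<omega> s. Z \<omega> * (indicator {0..t} s * Y s \<omega>)"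
  \<comment> \<open>Measurability of the identity into the coarser sigma-algebra carries joint
    measurability from \<open>F t\<close> over to \<open>M\<close>.\<close>
  have "(\<lambda>\<omega>. \<omega>) \<in> measurable M (F t)"
    using subalg[OF t] by (intro measurable_from_subalg[OF _ measurable_ident_sets]) auto
  then have "(\<lambda>p. (fst p, snd p)) \<in> measurable (M \<Otimes>\<^sub>M lborel) (F t \<Otimes>\<^sub>M lborel)"
    using measurable_compose[OF measurable_fst] by (intro measurable_Pair) auto
  from measurable_compose[OF this rc_jointly_measurable[OF Y t]]
  have "(\<lambda>(\<omega>, s). indicator {0..t} s * Y s \<omega>) \<in> borel_measurable (M \<Otimes>\<^sub>M lborel)"
    by (simp add: case_prod_beta')
  then have meas: "case_prod ?f \<in> borel_measurable (M \<Otimes>\<^sub>M lborel)"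
    using Z(1) by (simp add: case_prod_beta')
  show ?thesis
  proof (rule integrableI_bounded_set[where A = "space M \<times> {0..t}" and B = "D * C"])
    show "emeasure (M \<Otimes>\<^sub>M lborel) (space M \<times> {0..t}) < \<infinity>"
      using t by (subst lborel.emeasure_pair_measure_Times) (auto simp: emeasure_space_1)
    show "AE p in M \<Otimes>\<^sub>M lborel. p \<in> space M \<times> {0..t} \<longrightarrow> norm (case_prod ?f p) \<le> D * C"
      using t C Z(2) by (auto simp: abs_mult intro!: AE_I2 mult_mono')
    show "AE p in M \<Otimes>\<^sub>M lborel. p \<notin> space M \<times> {0..t} \<longrightarrow> case_prod ?f p = 0"
      by (intro AE_I2) (auto simp: space_pair_measure indicator_def)
  qed (use meas in auto)
qed

text \<open>Fubini with a bounded weight \<open>Z\<close>. The weight will be the indicator of a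
  past event in the martingale property, and the value of the martingale at the final time in the
  second moment.\<close>

lemma
  assumes Y: "rc_process Y" and t: "t \<in> {0..T}"
    and Z: "Z \<in> borel_measurable M" "\<And>\<omega>. \<omega> \<in> space M \<Longrightarrow> \<bar>Z \<omega>\<bar> \<le> D"
  shows rc_expectation_integrable: "set_integrable lborel {0..t} (\<lambda>s. \<integral>\<omega>. Z \<omega> * Y s \<omega> \<partial>M)"
    and rc_integral_expectation:
      "(\<integral>\<omega>. Z \<omega> * (LBINT s:{0..t}. Y s \<omega>) \<partial>M) = (LBINT s:{0..t}. (\<integral>\<omega>. Z \<omega> * Y s \<omega> \<partial>M))"
proof -
  interpret P: pair_sigma_finite M lborel ..
  let ?f = "\<lambda>\<omega> s. Z \<omega> * (indicator {0..t} s * Y s \<omega>)"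
  note int = rc_product_integrable[OF Y t Z]
  have eq: "(\<integral>\<omega>. ?f \<omega> s \<partial>M) = indicator {0..t} s * (\<integral>\<omega>. Z \<omega> * Y s \<omega> \<partial>M)" for s
    by (cases "s \<in> {0..t}") auto
  show "set_integrable lborel {0..t} (\<lambda>s. \<integral>\<omega>. Z \<omega> * Y s \<omega> \<partial>M)"
    using P.integrable_snd[OF int] unfolding eq by (simp add: set_integrable_def)
  show "(\<integral>\<omega>. Z \<omega> * (LBINT s:{0..t}. Y s \<omega>) \<partial>M) = (LBINT s:{0..t}. (\<integral>\<omega>. Z \<omega> * Y s \<omega> \<partial>M))"
    using P.Fubini_integral[OF int] unfolding eq set_lebesgue_integral_def real_scaleR_def by simp
qed

lemma rc_path_integral_square:
  assumes "rc_process Y" "t \<in> {0..T}" "\<omega> \<in> space M"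
  shows "(LBINT s:{0..t}. Y s \<omega> * (LBINT r:{0..s}. Y r \<omega>)) = (LBINT s:{0..t}. Y s \<omega>)\<^sup>2 / 2"
proof -
  let ?f = "\<lambda>s. indicator {0..t} s * Y s \<omega>"
  have "integrable lborel ?f"
    using rc_path_integrable[OF assms] by (simp add: set_integrable_def)
  note lborel_triangle_integral[OF this]
  moreover have "?f s * (\<integral>r. indicator {..s} r * ?f r \<partial>lborel)
      = indicator {0..t} s * (Y s \<omega> * (LBINT r:{0..s}. Y r \<omega>))" for s
  proof (cases "s \<in> {0..t}")
    case True
    have "(\<integral>r. indicator {..s} r * ?f r \<partial>lborel) = (LBINT r:{0..s}. Y r \<omega>)"
      unfolding set_lebesgue_integral_def
      by (intro Bochner_Integration.integral_cong) (use True in \<open>auto split: split_indicator\<close>)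
    then show ?thesis using True by simp
  qed simp
  ultimately show ?thesis by (simp add: set_lebesgue_integral_def)
qed


section \<open>Martingales tested against bounded past variables, and their second moment\<close>

text \<open>A bounded \<open>Z\<close> known at time \<open>s\<close> can be moved inside the
  conditional expectation given \<open>F s\<close>. The cases of interest are the constant 1, the
  initial value, and the drift at time \<open>s\<close>.\<close>

lemma martingale_mult_expectation:
  assumes X: "martingale_on T M F X" "rc_process X" and st: "0 \<le> s" "s \<le> t" "t \<le> T"
    and Z: "Z \<in> borel_measurable (F s)" "\<And>\<omega>. \<omega> \<in> space M \<Longrightarrow> \<bar>Z \<omega>\<bar> \<le> D"
  shows "(\<integral>\<omega>. Z \<omega> * X t \<omega> \<partial>M) = (\<integral>\<omega>. Z \<omega> * X s \<omega> \<partial>M)"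
proof -
  interpret sigma_finite_subalgebra M "F s"
    using st by (intro sigma_finite_filt) auto
  have [measurable]: "Z \<in> borel_measurable M"
    using Z(1) by (rule measurable_from_subalg[OF subalg])
  have [measurable]: "X t \<in> borel_measurable M" "X s \<in> borel_measurable M"
    using rc_measurable[OF X(2)] st by auto
  have "integrable M (\<lambda>\<omega>. Z \<omega> * X t \<omega>)"
    using Z st by (intro rc_mult_integrable[OF X(2)]) auto
  from real_cond_exp_intg(2)[OF this Z(1)]
  have "(\<integral>\<omega>. Z \<omega> * X t \<omega> \<partial>M) = (\<integral>\<omega>. Z \<omega> * real_cond_exp M (F s) (X t) \<omega> \<partial>M)"
    by simp
  also have "AE \<omega> in M. real_cond_exp M (F s) (X t) \<omega> = X s \<omega>"
    using X(1) st by (simp add: martingale_on_def)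
  then have "(\<integral>\<omega>. Z \<omega> * real_cond_exp M (F s) (X t) \<omega> \<partial>M) = (\<integral>\<omega>. Z \<omega> * X s \<omega> \<partial>M)"
    by (intro integral_cong_AE) auto
  finally show ?thesis .
qed

text \<open>Transfers the martingale property from the finite-sum form of the process to
  \<open>dynkin_mart\<close>; the two agree only on \<open>space M\<close> and for times in
  [0, T].\<close>

lemma martingale_on_cong:
  assumes "martingale_on T M F X" and eq: "\<And>t \<omega>. t \<in> {0..T} \<Longrightarrow> \<omega> \<in> space M \<Longrightarrow> X t \<omega> = Y t \<omega>"
  shows "martingale_on T M F Y"
  unfolding martingale_on_def
proof (intro conjI ballI allI impI)
  fix t assume t: "t \<in> {0..T}"
  then have X: "X t \<in> borel_measurable (F t)" "integrable M (X t)"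
    using assms(1) by (auto simp: martingale_on_def)
  show "subalgebra M (F t)" using t by (rule subalg)
  show "Y t \<in> borel_measurable (F t)"
    using X(1) eq[OF t] t measurable_cong[of "F t" "X t" "Y t"] by simp
  show "integrable M (Y t)"
    using X(2) eq[OF t] by (simp cong: Bochner_Integration.integrable_cong)
next
  fix s t :: real assume st: "0 \<le> s \<and> s \<le> t \<and> t \<le> T"
  then have ts: "s \<in> {0..T}" "t \<in> {0..T}" by auto
  show "sets (F s) \<subseteq> sets (F t)" using st filt_mono by simp
  interpret sigma_finite_subalgebra M "F s" by (rule sigma_finite_filt[OF ts(1)])
  have X: "integrable M (X t)" "AE \<omega> in M. real_cond_exp M (F s) (X t) \<omega> = X s \<omega>"
    using assms(1) st ts by (auto simp: martingale_on_def)
  have Y: "integrable M (Y t)"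
    using X(1) eq[OF ts(2)] by (simp cong: Bochner_Integration.integrable_cong)
  have "AE \<omega> in M. real_cond_exp M (F s) (X t) \<omega> = real_cond_exp M (F s) (Y t) \<omega>"
    using X(1) Y eq[OF ts(2)] by (intro real_cond_exp_cong AE_I2) auto
  with X(2) AE_space show "AE \<omega> in M. real_cond_exp M (F s) (Y t) \<omega> = Y s \<omega>"
    by eventually_elim (use eq[OF ts(1)] in simp)
qed

lemma rc_integrable_path_integral:
  "rc_process Y \<Longrightarrow> t \<in> {0..T} \<Longrightarrow> integrable M (\<lambda>\<omega>. LBINT s:{0..t}. Y s \<omega>)"
  by (rule rc_integrable[OF rc_process_integral])

text \<open>Writing \<open>X\<close> for the first martingale and \<open>I\<close> for the integral of \<open>c\<close>, the
  square of \<open>X\<^sub>t\<close> is \<open>U\<^sub>t\<^sup>2 - U\<^sub>0\<^sup>2 - 2 U\<^sub>0 X\<^sub>t - 2 U\<^sub>0 I\<^sub>t - 2 X\<^sub>t I\<^sub>t - I\<^sub>t\<^sup>2\<close>, and the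
  martingale property turns the expectation of \<open>X\<^sub>t I\<^sub>t\<close> into that of \<open>\<integral> X\<^sub>s c\<^sub>s ds\<close>.\<close>

theorem martingale_second_moment:
  assumes U: "rc_process U" and c: "rc_process c" and d: "rc_process d"
    and mart: "martingale_on T M F (\<lambda>t \<omega>. U t \<omega> - U 0 \<omega> - (LBINT s:{0..t}. c s \<omega>))"
    and mart2: "martingale_on T M F (\<lambda>t \<omega>. (U t \<omega>)\<^sup>2 - (U 0 \<omega>)\<^sup>2 - (LBINT s:{0..t}. d s \<omega>))"
    and t: "t \<in> {0..T}"
  shows "(\<integral>\<omega>. (U t \<omega> - U 0 \<omega> - (LBINT s:{0..t}. c s \<omega>))\<^sup>2 \<partial>M) =
    (\<integral>\<omega>. (LBINT s:{0..t}. d s \<omega> - 2 * U s \<omega> * c s \<omega>) \<partial>M)"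
proof -
  have T: "T \<ge> 0" using t by simp
  define I where "I = (\<lambda>t \<omega>. LBINT s:{0..t}. c s \<omega>)"
  define X where "X = (\<lambda>t \<omega>. U t \<omega> - U 0 \<omega> - I t \<omega>)"
  define N where "N = (\<lambda>t \<omega>. (U t \<omega>)\<^sup>2 - (U 0 \<omega>)\<^sup>2 - (LBINT s:{0..t}. d s \<omega>))"
  have I: "rc_process I" unfolding I_def by (rule rc_process_integral[OF c])
  have X: "rc_process X"
    unfolding X_def I_def by (rule rc_process_shifted_integral[OF U c T])
  have UU: "rc_process (\<lambda>t \<omega>. (U t \<omega>)\<^sup>2)"
    unfolding power2_eq_square by (rule rc_process_mult[OF U U])
  have N: "rc_process N"
    unfolding N_def by (rule rc_process_shifted_integral[OF UU d T])
  note Uc = rc_process_mult[OF U c]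
  have U0: "rc_process (\<lambda>t. U 0)" using U T by (rule rc_process_initial)
  note ints [simp] = rc_integrable[OF rc_process_mult[OF U0 X] t] rc_integrable[OF rc_process_mult[OF U0 I] t]
    rc_integrable[OF N t] rc_integrable[OF rc_process_mult[OF X I] t]
    rc_integrable[OF rc_process_mult[OF I I] t]
    rc_integrable_path_integral[OF d t] rc_integrable_path_integral[OF Uc t]
  define D where "D = rc_bound U"
  note D = rc_bound_nonneg[OF U, folded D_def] rc_bound[OF U, folded D_def]
  define C where "C = rc_bound c"
  note C = rc_bound_nonneg[OF c, folded C_def] rc_bound[OF c, folded C_def]
  define B where "B = rc_bound X"
  note B = rc_bound_nonneg[OF X, folded B_def] rc_bound[OF X, folded B_def]
  have mX: "martingale_on T M F X" using mart by (simp add: X_def I_def)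
  have mN: "martingale_on T M F N" using mart2 by (simp add: N_def)
  have EN: "(\<integral>\<omega>. N t \<omega> \<partial>M) = 0"
    using martingale_mult_expectation[OF mN N, of 0 t "\<lambda>_. 1" 1] t
    by (simp add: N_def set_integral_lborel_singleton)
  have EUX: "(\<integral>\<omega>. U 0 \<omega> * X t \<omega> \<partial>M) = 0"
    using martingale_mult_expectation[OF mX X, of 0 t "U 0" D] t D(2)[of 0] rc_adapted[OF U, of 0]
    by (simp add: X_def I_def set_integral_lborel_singleton)
  have EXI: "(\<integral>\<omega>. X t \<omega> * I t \<omega> \<partial>M) = (\<integral>\<omega>. (LBINT s:{0..t}. X s \<omega> * c s \<omega>) \<partial>M)"
  proof -
    have "(\<integral>\<omega>. X t \<omega> * I t \<omega> \<partial>M) = (LBINT s:{0..t}. (\<integral>\<omega>. X t \<omega> * c s \<omega> \<partial>M))"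
      unfolding I_def by (rule rc_integral_expectation[OF c t rc_measurable[OF X t] B(2)[OF t]])
    \<comment> \<open>For fixed \<open>s\<close> the drift \<open>c s\<close> is a bounded past
      variable, so \<open>X t\<close> may be replaced by \<open>X s\<close>. The factor 1 is the
      weight with which Fubini is then applied backwards.\<close>
    also have "\<dots> = (LBINT s:{0..t}. (\<integral>\<omega>. 1 * (X s \<omega> * c s \<omega>) \<partial>M))"
    proof (rule set_lebesgue_integral_cong, simp, intro allI impI)
      fix s assume "s \<in> {0..t}"
      then show "(\<integral>\<omega>. X t \<omega> * c s \<omega> \<partial>M) = (\<integral>\<omega>. 1 * (X s \<omega> * c s \<omega>) \<partial>M)"
        using martingale_mult_expectation[OF mX X, of s t "c s" C] rc_adapted[OF c, of s] C(2)[of s] t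
        by (simp add: mult.commute)
    qed
    also have "\<dots> = (\<integral>\<omega>. 1 * (LBINT s:{0..t}. X s \<omega> * c s \<omega>) \<partial>M)"
      by (rule rc_integral_expectation[OF rc_process_mult[OF X c] t, symmetric, of _ 1]) auto
    finally show ?thesis by simp
  qed
  \<comment> \<open>Substitute the definition of \<open>X s\<close>; the part
    \<open>c s * I s\<close> integrates to half a square by the triangle identity.\<close>
  have path: "(LBINT s:{0..t}. X s \<omega> * c s \<omega>) =
      (LBINT s:{0..t}. U s \<omega> * c s \<omega>) - U 0 \<omega> * I t \<omega> - (I t \<omega>)\<^sup>2 / 2" if "\<omega> \<in> space M" for \<omega>
  proof -
    note p = rc_path_integrable[OF _ t that]
    have "(LBINT s:{0..t}. X s \<omega> * c s \<omega>) =
        (LBINT s:{0..t}. U s \<omega> * c s \<omega> - U 0 \<omega> * c s \<omega> - c s \<omega> * I s \<omega>)"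
      by (simp add: X_def algebra_simps)
    also have "\<dots> = (LBINT s:{0..t}. U s \<omega> * c s \<omega>) - (LBINT s:{0..t}. U 0 \<omega> * c s \<omega>)
        - (LBINT s:{0..t}. c s \<omega> * I s \<omega>)"
      using p[OF Uc] p[OF rc_process_mult[OF U0 c]] p[OF rc_process_mult[OF c I]]
      by (simp add: set_integral_diff(1,2))
    also have "(LBINT s:{0..t}. c s \<omega> * I s \<omega>) = (I t \<omega>)\<^sup>2 / 2"
      unfolding I_def by (rule rc_path_integral_square[OF c t that])
    finally show ?thesis by (simp add: I_def)
  qed
  have path2: "(LBINT s:{0..t}. d s \<omega> - 2 * U s \<omega> * c s \<omega>) =
      (LBINT s:{0..t}. d s \<omega>) - 2 * (LBINT s:{0..t}. U s \<omega> * c s \<omega>)" if "\<omega> \<in> space M" for \<omega>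
    using rc_path_integrable[OF d t that] rc_path_integrable[OF rc_process_cmult[OF Uc, of 2] t that]
    by (simp add: set_integral_diff mult.assoc)
  have "(X t \<omega>)\<^sup>2 = (N t \<omega> + (LBINT s:{0..t}. d s \<omega>) - 2 * (U 0 \<omega> * X t \<omega>) - 2 * (U 0 \<omega> * I t \<omega>)
      - I t \<omega> * I t \<omega>) - 2 * (X t \<omega> * I t \<omega>)" for \<omega>
    by (simp add: X_def N_def power2_eq_square algebra_simps)
  then have "(\<integral>\<omega>. (X t \<omega>)\<^sup>2 \<partial>M) = (\<integral>\<omega>. (LBINT s:{0..t}. d s \<omega>) \<partial>M)
      - 2 * (\<integral>\<omega>. U 0 \<omega> * I t \<omega> \<partial>M) - (\<integral>\<omega>. I t \<omega> * I t \<omega> \<partial>M) - 2 * (\<integral>\<omega>. X t \<omega> * I t \<omega> \<partial>M)"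
    using EN EUX by simp
  \<comment> \<open>After multiplication by -2, the last two terms on the right cancel the
    expectations of \<open>U 0 * I t\<close> and \<open>I t * I t\<close> already present, and only
    \<open>d\<close> and \<open>U * c\<close> remain.\<close>
  also have "(\<integral>\<omega>. X t \<omega> * I t \<omega> \<partial>M) = (\<integral>\<omega>. (LBINT s:{0..t}. U s \<omega> * c s \<omega>) - U 0 \<omega> * I t \<omega>
      - 1/2 * (I t \<omega> * I t \<omega>) \<partial>M)"
    unfolding EXI by (rule Bochner_Integration.integral_cong) (simp_all add: path power2_eq_square)
  also have "\<dots> = (\<integral>\<omega>. (LBINT s:{0..t}. U s \<omega> * c s \<omega>) \<partial>M) - (\<integral>\<omega>. U 0 \<omega> * I t \<omega> \<partial>M)
      - 1/2 * (\<integral>\<omega>. I t \<omega> * I t \<omega> \<partial>M)"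
    by simp
  finally have "(\<integral>\<omega>. (X t \<omega>)\<^sup>2 \<partial>M) =
      (\<integral>\<omega>. (LBINT s:{0..t}. d s \<omega>) \<partial>M) - 2 * (\<integral>\<omega>. (LBINT s:{0..t}. U s \<omega> * c s \<omega>) \<partial>M)"
    by simp
  moreover have "(\<integral>\<omega>. (LBINT s:{0..t}. d s \<omega> - 2 * U s \<omega> * c s \<omega>) \<partial>M) =
      (\<integral>\<omega>. (LBINT s:{0..t}. d s \<omega>) - 2 * (LBINT s:{0..t}. U s \<omega> * c s \<omega>) \<partial>M)"
    by (rule Bochner_Integration.integral_cong) (simp_all add: path2)
  ultimately show ?thesis by (simp add: X_def I_def)
qed

end

section \<open>Markov semigroups and Dynkin's formula\<close>

locale markov_semigroup_bcontfun =
  fixes S :: "real \<Rightarrow> ('a::topological_space \<Rightarrow>\<^sub>C real) \<Rightarrow> ('a \<Rightarrow>\<^sub>C real)"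
  assumes markov_semigroup: "markov_semigroup S"
begin

lemma
  shows semigroup_linear: "t \<ge> 0 \<Longrightarrow> linear (S t)"
    and semigroup_0: "S 0 f = f"
    and semigroup_add: "s \<ge> 0 \<Longrightarrow> t \<ge> 0 \<Longrightarrow> S (s + t) f = S s (S t f)"
    and semigroup_one: "t \<ge> 0 \<Longrightarrow> S t (const_bcontfun 1) = const_bcontfun 1"
    and semigroup_nonneg: "t \<ge> 0 \<Longrightarrow> (\<And>x. 0 \<le> f x) \<Longrightarrow> 0 \<le> S t f x"
    and semigroup_tendsto: "((\<lambda>t. S t f) \<longlongrightarrow> f) (at_right 0)"
  using markov_semigroup by (auto simp: markov_semigroup_def)

text \<open>Both \<open>norm f - f\<close> and \<open>norm f + f\<close> are nonnegative; positivity
  of \<open>S t\<close> preserves this, and \<open>S t\<close> fixes constants.\<close>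

lemma semigroup_contraction:
  assumes "t \<ge> 0"
  shows "norm (S t f) \<le> norm f"
proof (rule norm_bound)
  fix x
  note lin = semigroup_linear[OF assms]
  have S_const: "S t (norm f *\<^sub>R const_bcontfun 1) = norm f *\<^sub>R const_bcontfun 1"
    by (simp add: linear_scale[OF lin] semigroup_one[OF assms])
  have "\<bar>f y\<bar> \<le> norm f" for y
    using norm_bounded[of f y] by simp
  then have "0 \<le> (norm f *\<^sub>R const_bcontfun 1 - f) y" "0 \<le> (norm f *\<^sub>R const_bcontfun 1 + f) y" for y
    using abs_le_D1[of "f y" "norm f"] abs_le_D2[of "f y" "norm f"]
    by (auto simp: const_bcontfun.rep_eq)
  then have "0 \<le> S t (norm f *\<^sub>R const_bcontfun 1 - f) x" "0 \<le> S t (norm f *\<^sub>R const_bcontfun 1 + f) x"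
    using semigroup_nonneg[OF assms] by blast+
  then have "0 \<le> norm f - S t f x" "0 \<le> norm f + S t f x"
    by (simp_all add: linear_diff[OF lin] linear_add[OF lin] S_const const_bcontfun.rep_eq)
  then show "norm (S t f x) \<le> norm f"
    unfolding real_norm_def by linarith
qed

text \<open>For u \<le> v the increment is \<open>S u\<close> applied to
  \<open>S (v - u) f - f\<close>, and \<open>S u\<close> is a contraction. Continuity at any time,
  from the left as well as from the right, thus reduces to right continuity at 0.\<close>

lemma semigroup_dist:
  assumes "s \<ge> 0" "t \<ge> 0"
  shows "norm (S s f - S t f) \<le> norm (S \<bar>s - t\<bar> f - f)"
proof -
  have *: "norm (S v f - S u f) \<le> norm (S (v - u) f - f)" if "0 \<le> u" "u \<le> v" for u v
  proof -
    have "S v f - S u f = S u (S (v - u) f - f)"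
      using semigroup_add[of u "v - u" f] linear_diff[OF semigroup_linear[of u]] that by simp
    then show ?thesis using semigroup_contraction[of u] that by simp
  qed
  show ?thesis
  proof (cases "s \<le> t")
    case True
    then show ?thesis using *[of s t] assms by (simp add: norm_minus_commute)
  next
    case False
    then show ?thesis using *[of t s] assms by simp
  qed
qed

lemma semigroup_right_cont_0:
  assumes "e > 0"
  obtains d where "d > 0" "\<And>h. 0 \<le> h \<Longrightarrow> h < d \<Longrightarrow> norm (S h f - f) < e"
proof -
  have "\<forall>\<^sub>F h in at_right 0. dist (S h f) f < e"
    using tendstoD[OF semigroup_tendsto assms] .
  then obtain d where d: "d > 0" "\<And>h. 0 < h \<Longrightarrow> h < d \<Longrightarrow> dist (S h f) f < e"
    by (auto simp: eventually_at_right[of 0 1])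
  have "norm (S h f - f) < e" if "0 \<le> h" "h < d" for h
    using d(2)[of h] that assms by (cases "h = 0") (auto simp: dist_norm semigroup_0)
  with d(1) show ?thesis by (rule that)
qed

lemma continuous_on_semigroup: "continuous_on {0..} (\<lambda>t. S t f)"
  unfolding continuous_on_iff
proof (intro ballI allI impI)
  fix t e :: real
  assume t: "t \<in> {0..}" and "e > 0"
  then obtain d where d: "d > 0" "\<And>h. 0 \<le> h \<Longrightarrow> h < d \<Longrightarrow> norm (S h f - f) < e"
    using semigroup_right_cont_0[of e f] by metis
  have "dist (S r f) (S t f) < e" if "r \<in> {0..}" "dist r t < d" for r
  proof -
    have "norm (S r f - S t f) \<le> norm (S \<bar>r - t\<bar> f - f)"
      using t that by (intro semigroup_dist) auto
    also have "\<dots> < e" using that by (intro d(2)) (auto simp: dist_real_def)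
    finally show ?thesis by (simp add: dist_norm)
  qed
  then show "\<exists>d>0. \<forall>r\<in>{0..}. dist r t < d \<longrightarrow> dist (S r f) (S t f) < e"
    using d(1) by (intro exI[of _ d]) simp
qed

text \<open>The generator provides only a right derivative at time 0. To the right of
  \<open>t\<close>, apply \<open>S t\<close> to the increment at 0. To the left, apply the semigroup
  at the earlier time \<open>r\<close>; this produces \<open>S r g\<close> instead of
  \<open>S t g\<close>, and strong continuity bounds the difference. Each of the two errors is given
  half of \<open>e\<close>.\<close>

lemma has_vector_derivative_semigroup:
  assumes gen: "(f, g) \<in> generator_graph S" and t: "t \<ge> 0"
  shows "((\<lambda>r. S r f) has_vector_derivative S t g) (at t within {0..})"
  unfolding has_vector_derivative_def has_derivative_within_alt
proof (intro conjI allI impI)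
  fix e :: real
  assume e: "e > 0"
  have "((\<lambda>h. (1 / h) *\<^sub>R (S h f - f)) \<longlongrightarrow> g) (at_right 0)"
    using gen by (simp add: generator_graph_def)
  then have "\<forall>\<^sub>F h in at_right 0. dist ((1 / h) *\<^sub>R (S h f - f)) g < e / 2"
    using e by (intro tendstoD) auto
  then obtain d1 where d1: "d1 > 0" "\<And>h. 0 < h \<Longrightarrow> h < d1 \<Longrightarrow> dist ((1 / h) *\<^sub>R (S h f - f)) g < e / 2"
    by (auto simp: eventually_at_right[of 0 1])
  obtain d2 where d2: "d2 > 0" "\<And>h. 0 \<le> h \<Longrightarrow> h < d2 \<Longrightarrow> norm (S h g - g) < e / 2"
    using semigroup_right_cont_0[of "e / 2" g] e by (metis half_gt_zero)
  have incr: "norm (S h f - f - h *\<^sub>R g) \<le> e / 2 * h" if "0 \<le> h" "h < d1" for h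
  proof (cases "h = 0")
    case False
    then have h: "h > 0" using that by simp
    have "S h f - f - h *\<^sub>R g = h *\<^sub>R ((1 / h) *\<^sub>R (S h f - f) - g)"
      using h by (simp add: scaleR_diff_right)
    then have "norm (S h f - f - h *\<^sub>R g) = h * norm ((1 / h) *\<^sub>R (S h f - f) - g)"
      using h by simp
    also have "\<dots> \<le> h * (e / 2)"
      using d1(2)[OF h that(2)] h by (intro mult_left_mono) (auto simp: dist_norm)
    finally show ?thesis by (simp add: mult.commute)
  qed (simp add: semigroup_0)
  have "norm (S r f - S t f - (r - t) *\<^sub>R S t g) \<le> e * norm (r - t)"
    if r: "r \<ge> 0" "norm (r - t) < min d1 d2" for r
  proof -
    \<comment> \<open>Factoring out the semigroup at the earlier of the two times gives both cases
      the same remainder, that of the increment over \<open>?h\<close> starting at 0.\<close>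
    let ?u = "min r t" and ?h = "\<bar>r - t\<bar>"
    have u: "?u \<ge> 0" using r t by simp
    note lin = semigroup_linear[OF u]
    have e2: "e / 2 * ?h \<le> e * ?h" using e by (intro mult_right_mono) auto
    have 1: "norm (S ?u (S ?h f - f - ?h *\<^sub>R g)) \<le> e / 2 * ?h"
      using incr[of ?h] r by (intro order_trans[OF semigroup_contraction[OF u]]) simp
    have 2: "norm (S ?u g - S t g) \<le> e / 2"
    proof -
      have "norm (S ?u g - S t g) \<le> norm (S \<bar>?u - t\<bar> g - g)"
        by (rule semigroup_dist[OF u t])
      also have "\<dots> \<le> e / 2"
      proof (rule less_imp_le, rule d2(2))
        have "\<bar>?u - t\<bar> \<le> \<bar>r - t\<bar>" by (simp add: min_def)
        also have "\<dots> < d2" using r by simp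
        finally show "\<bar>?u - t\<bar> < d2" .
      qed simp
      finally show ?thesis .
    qed
    show ?thesis
    proof (cases "t \<le> r")
      case True
      have "S r f - S t f - (r - t) *\<^sub>R S t g = S ?u (S ?h f - f - ?h *\<^sub>R g)"
        using True semigroup_add[of t "r - t" f] t lin by (simp add: linear_diff linear_scale)
      then show ?thesis using 1 e2 by simp
    next
      case False
      have "S r f - S t f - (r - t) *\<^sub>R S t g
          = - (S ?u (S ?h f - f - ?h *\<^sub>R g)) - ?h *\<^sub>R (S ?u g - S t g)"
        using False semigroup_add[of r "t - r" f] r lin
        by (simp add: linear_diff linear_scale linear_add algebra_simps)
      then have "norm (S r f - S t f - (r - t) *\<^sub>R S t g)
          \<le> norm (S ?u (S ?h f - f - ?h *\<^sub>R g)) + norm (?h *\<^sub>R (S ?u g - S t g))"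
        using norm_triangle_ineq4[of "- (S ?u (S ?h f - f - ?h *\<^sub>R g))" "?h *\<^sub>R (S ?u g - S t g)"]
        by (simp only: norm_minus_cancel)
      also have "\<dots> \<le> e / 2 * ?h + ?h * (e / 2)"
        unfolding norm_scaleR abs_abs using 1 2 by (intro add_mono mult_left_mono) simp_all
      finally show ?thesis by simp
    qed
  qed
  then show "\<exists>d>0. \<forall>r\<in>{0..}. norm (r - t) < d \<longrightarrow>
      norm (S r f - S t f - (r - t) *\<^sub>R S t g) \<le> e * norm (r - t)"
    using d1(1) d2(1) by (intro exI[of _ "min d1 d2"]) auto
qed (rule bounded_linear_scaleR_left)

end

section \<open>Right-continuous Markov processes and their Dynkin martingales\<close>

text \<open>The state space is kept as an abstract topological space. \<open>sets_N\<close> ties its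
  sigma-algebra to the topology, so that bounded continuous functions of the process are adapted to
  the natural filtration.\<close>

locale feller_process = prob_space M + markov_semigroup_bcontfun S
  for M :: "'w measure"
    and S :: "real \<Rightarrow> ('a::topological_space \<Rightarrow>\<^sub>C real) \<Rightarrow> ('a \<Rightarrow>\<^sub>C real)" +
  fixes T :: real and N :: "'a measure" and X :: "real \<Rightarrow> 'w \<Rightarrow> 'a"
  assumes sets_N: "sets N = sets borel"
    and X_measurable: "t \<in> {0..T} \<Longrightarrow> X t \<in> measurable M N"
    and X_right_cont: "\<omega> \<in> space M \<Longrightarrow> t \<in> {0..<T} \<Longrightarrow> ((\<lambda>s. X s \<omega>) \<longlongrightarrow> X t \<omega>) (at_right t)"
    and markov: "0 \<le> s \<Longrightarrow> s \<le> t \<Longrightarrow> t \<le> T \<Longrightarrow>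
      AE \<omega> in M. real_cond_exp M (natural_filtration M N X s) (\<lambda>\<omega>. apply_bcontfun f (X t \<omega>)) \<omega>
        = apply_bcontfun (S (t - s) f) (X s \<omega>)"
begin

abbreviation F :: "real \<Rightarrow> 'w measure" where
  "F \<equiv> natural_filtration M N X"

lemma space_F [simp]: "space (F t) = space M"
  unfolding natural_filtration_def by (intro space_measure_of) auto

lemma sets_F: "sets (F t) = sigma_sets (space M) (\<Union>s\<in>{0..t}. {X s -` A \<inter> space M | A. A \<in> sets N})"
  unfolding natural_filtration_def by (intro sets_measure_of) auto

sublocale bounded_filtration M T F
proof
  show "subalgebra M (F t)" if "t \<in> {0..T}" for t
  proof -
    have "sigma_sets (space M) (\<Union>s\<in>{0..t}. {X s -` A \<inter> space M | A. A \<in> sets N}) \<subseteq> sets M"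
      using measurable_sets[OF X_measurable] that by (intro sets.sigma_sets_subset) auto
    then show ?thesis by (simp add: subalgebra_def sets_F)
  qed
  show "sets (F s) \<subseteq> sets (F t)" if "0 \<le> s" "s \<le> t" "t \<le> T" for s t
    unfolding sets_F using that by (intro sigma_sets_mono') fastforce
qed

lemma X_adapted:
  assumes "t \<in> {0..T}"
  shows "X t \<in> measurable (F t) N"
proof (rule measurableI)
  show "X t \<omega> \<in> space N" if "\<omega> \<in> space (F t)" for \<omega>
    using measurable_space[OF X_measurable[OF assms]] that by simp
  show "X t -` A \<inter> space (F t) \<in> sets (F t)" if "A \<in> sets N" for A
    unfolding sets_F space_F using assms that
    by (intro sigma_sets.Basic UN_I[of t]) auto
qed

lemma rc_process_bcontfun: "rc_process (\<lambda>t \<omega>. apply_bcontfun f (X t \<omega>))"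
  unfolding rc_process_def
proof (intro conjI ballI)
  show "(\<lambda>\<omega>. f (X t \<omega>)) \<in> borel_measurable (F t)" if "t \<in> {0..T}" for t
  proof (rule measurable_compose[OF X_adapted[OF that]])
    have "apply_bcontfun f \<in> borel_measurable borel"
      by (intro borel_measurable_continuous_onI continuous_on_apply_bcontfun)
    then show "apply_bcontfun f \<in> borel_measurable N"
      using measurable_cong_sets[OF sets_N refl] by blast
  qed
  show "((\<lambda>s. f (X s \<omega>)) \<longlongrightarrow> f (X t \<omega>)) (at_right t)" if "\<omega> \<in> space M" "t \<in> {0..<T}" for \<omega> t
    by (rule continuous_on_tendsto_compose[of UNIV, OF continuous_on_apply_bcontfun X_right_cont[OF that]]) auto
  show "\<exists>C\<ge>0. \<forall>t\<in>{0..T}. \<forall>\<omega>\<in>space M. \<bar>f (X t \<omega>)\<bar> \<le> C"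
    using norm_bounded[of f] by (intro exI[of _ "norm f"]) auto
qed


text \<open>This is the Markov property integrated against \<open>Z\<close>. On the right the later
  time enters only through the semigroup, so regularity in \<open>t\<close> can be read off in the
  uniform norm.\<close>

lemma expectation_semigroup:
  assumes st: "0 \<le> s" "s \<le> t" "t \<le> T"
    and Z: "Z \<in> borel_measurable (F s)" "\<And>\<omega>. \<omega> \<in> space M \<Longrightarrow> \<bar>Z \<omega>\<bar> \<le> D"
  shows "(\<integral>\<omega>. Z \<omega> * apply_bcontfun f (X t \<omega>) \<partial>M) =
    (\<integral>\<omega>. Z \<omega> * apply_bcontfun (S (t - s) f) (X s \<omega>) \<partial>M)"
proof -
  interpret sigma_finite_subalgebra M "F s"
    using st by (intro sigma_finite_filt) auto
  have ZM: "Z \<in> borel_measurable M"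
    using Z(1) by (rule measurable_from_subalg[OF subalg])
  have ts: "t \<in> {0..T}" "s \<in> {0..T}" using st by auto
  note m = rc_measurable[OF rc_process_bcontfun]
  from real_cond_exp_intg(2)[OF rc_mult_integrable[OF rc_process_bcontfun ts(1) ZM Z(2)] Z(1) m[OF ts(1)]]
  have "(\<integral>\<omega>. Z \<omega> * apply_bcontfun f (X t \<omega>) \<partial>M) =
      (\<integral>\<omega>. Z \<omega> * real_cond_exp M (F s) (\<lambda>\<omega>. f (X t \<omega>)) \<omega> \<partial>M)"
    by simp
  also have "\<dots> = (\<integral>\<omega>. Z \<omega> * apply_bcontfun (S (t - s) f) (X s \<omega>) \<partial>M)"
  proof (rule integral_cong_AE)
    show "AE \<omega> in M. Z \<omega> * real_cond_exp M (F s) (\<lambda>\<omega>. f (X t \<omega>)) \<omega> = Z \<omega> * S (t - s) f (X s \<omega>)"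
      using markov[OF st, of f] by eventually_elim simp
  qed (intro borel_measurable_times ZM m[OF ts(2)] borel_measurable_cond_exp2)+
  finally show ?thesis .
qed

text \<open>Being a continuous functional of \<open>f\<close>, the expectation commutes with
  derivatives of semigroup orbits; this turns a derivative in the uniform norm into a real
  one.\<close>

lemma bounded_linear_expectation:
  fixes Z :: "'w \<Rightarrow> real"
  assumes "s \<in> {0..T}" "Z \<in> borel_measurable M" "\<And>\<omega>. \<omega> \<in> space M \<Longrightarrow> \<bar>Z \<omega>\<bar> \<le> D"
  shows "bounded_linear (\<lambda>f. \<integral>\<omega>. Z \<omega> * apply_bcontfun f (X s \<omega>) \<partial>M)"
proof (rule bounded_linear_intro)
  have int: "integrable M (\<lambda>\<omega>. Z \<omega> * apply_bcontfun f (X s \<omega>))" for f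
    by (rule rc_mult_integrable[OF rc_process_bcontfun assms])
  show "(\<integral>\<omega>. Z \<omega> * apply_bcontfun (f + g) (X s \<omega>) \<partial>M) =
      (\<integral>\<omega>. Z \<omega> * f (X s \<omega>) \<partial>M) + (\<integral>\<omega>. Z \<omega> * g (X s \<omega>) \<partial>M)" for f g
    using int by (simp add: distrib_left)
  show "(\<integral>\<omega>. Z \<omega> * apply_bcontfun (r *\<^sub>R f) (X s \<omega>) \<partial>M) = r *\<^sub>R (\<integral>\<omega>. Z \<omega> * f (X s \<omega>) \<partial>M)" for r f
    by (simp add: mult.left_commute)
  show "norm (\<integral>\<omega>. Z \<omega> * apply_bcontfun f (X s \<omega>) \<partial>M) \<le> norm f * \<bar>D\<bar>" for f
  proof -
    have "\<bar>Z \<omega> * f (X s \<omega>)\<bar> \<le> norm f * \<bar>D\<bar>" if "\<omega> \<in> space M" for \<omega>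
      using mult_mono'[OF norm_bounded[of f "X s \<omega>"] order_trans[OF assms(3)[OF that] abs_ge_self]]
      by (simp add: abs_mult mult.commute)
    then have "\<bar>\<integral>\<omega>. Z \<omega> * apply_bcontfun f (X s \<omega>) \<partial>M\<bar> \<le> (\<integral>\<omega>. norm f * \<bar>D\<bar> \<partial>M)"
      using int[of f] by (intro order_trans[OF integral_abs_bound] integral_mono) auto
    then show ?thesis by (simp add: prob_space)
  qed
qed


text \<open>On each summand, \<open>E[Z h\<^sub>i(X\<^sub>r)] = E[Z (S\<^sub>r\<^sub>-\<^sub>s h\<^sub>i)(X\<^sub>s)]\<close> is continuously
  differentiable in \<open>r\<close>, so that the martingale property is the fundamental theorem of calculus.\<close>

theorem dynkin_martingale:
  fixes h k :: "'i \<Rightarrow> 'a \<Rightarrow>\<^sub>C real" and g g' :: "'i \<Rightarrow> real \<Rightarrow> real"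
  assumes gen: "\<And>i. i \<in> I \<Longrightarrow> (h i, k i) \<in> generator_graph S"
    and deriv: "\<And>i t. i \<in> I \<Longrightarrow> t \<in> {0..T} \<Longrightarrow> (g i has_real_derivative g' i t) (at t within {0..})"
    and cont: "\<And>i. i \<in> I \<Longrightarrow> continuous_on {0..T} (g' i)"
  defines "U \<equiv> \<lambda>t \<omega>. \<Sum>i\<in>I. g i t * apply_bcontfun (h i) (X t \<omega>)"
    and "c \<equiv> \<lambda>t \<omega>. \<Sum>i\<in>I. g' i t * apply_bcontfun (h i) (X t \<omega>) + g i t * apply_bcontfun (k i) (X t \<omega>)"
  shows rc_process_dynkin_fun: "rc_process U"
    and rc_process_dynkin_deriv: "rc_process c"
    and martingale_dynkin: "martingale_on T M F (\<lambda>t \<omega>. U t \<omega> - U 0 \<omega> - (LBINT s:{0..t}. c s \<omega>))"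
proof -
  have contg: "continuous_on {0..T} (g i)" if "i \<in> I" for i
    using deriv[OF that] has_field_derivative_subset[of "g i" _ _ "{0..}" "{0..T}"]
    by (intro DERIV_continuous_on[where D = "g' i"]) auto
  show U: "rc_process U"
    unfolding U_def
    by (intro rc_process_sum rc_process_mult rc_process_deterministic rc_process_bcontfun contg)
  show c: "rc_process c"
    unfolding c_def
    by (intro rc_process_sum rc_process_add rc_process_mult rc_process_deterministic
        rc_process_bcontfun contg cont)
  \<comment> \<open>Dynkin's formula in expectation. It is stated on [s, t] because the Markov
    property can be integrated against \<open>Z\<close> only from time \<open>s\<close> on, when
    \<open>Z\<close> is known. There \<open>?\<phi>\<close> and \<open>?\<psi>\<close> are the
    expectations of \<open>Z * U\<close> and \<open>Z * c\<close> rewritten through the semigroup,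
    and \<open>?\<psi>\<close> is the derivative of \<open>?\<phi>\<close> by the product
    rule.\<close>
  have key: "(\<integral>\<omega>. Z \<omega> * U t \<omega> \<partial>M) - (\<integral>\<omega>. Z \<omega> * U s \<omega> \<partial>M) =
      (LBINT r:{s..t}. (\<integral>\<omega>. Z \<omega> * c r \<omega> \<partial>M))"
    if st: "0 \<le> s" "s \<le> t" "t \<le> T" and Z: "Z \<in> borel_measurable (F s)"
      "\<And>\<omega>. \<omega> \<in> space M \<Longrightarrow> \<bar>Z \<omega>\<bar> \<le> D" for s t Z D
  proof -
    have ZM: "Z \<in> borel_measurable M"
      using Z(1) st by (intro measurable_from_subalg[OF subalg]) auto
    define L where "L = (\<lambda>f. \<integral>\<omega>. Z \<omega> * apply_bcontfun f (X s \<omega>) \<partial>M)"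
    interpret L: bounded_linear L
      unfolding L_def by (rule bounded_linear_expectation[OF _ ZM Z(2)]) (use st in auto)
    have EL: "(\<integral>\<omega>. Z \<omega> * apply_bcontfun f (X r \<omega>) \<partial>M) = L (S (r - s) f)" if "r \<in> {s..t}" for f r
      unfolding L_def by (rule expectation_semigroup[OF _ _ _ Z]) (use that st in auto)
    have int: "integrable M (\<lambda>\<omega>. Z \<omega> * apply_bcontfun f (X r \<omega>))" if "r \<in> {s..t}" for f r
      by (rule rc_mult_integrable[OF rc_process_bcontfun _ ZM Z(2)]) (use that st in auto)
    have lc: "Z \<omega> * (a * x) = a * (Z \<omega> * x)" for a x \<omega>
      by (rule mult.left_commute)
    let ?\<phi> = "\<lambda>r. \<Sum>i\<in>I. g i r * L (S (r - s) (h i))"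
    let ?\<psi> = "\<lambda>r. \<Sum>i\<in>I. g' i r * L (S (r - s) (h i)) + g i r * L (S (r - s) (k i))"
    have EU: "(\<integral>\<omega>. Z \<omega> * U r \<omega> \<partial>M) = ?\<phi> r" if "r \<in> {s..t}" for r
      using int[OF that] by (simp add: U_def sum_distrib_left lc EL[OF that])
    have Ec: "(\<integral>\<omega>. Z \<omega> * c r \<omega> \<partial>M) = ?\<psi> r" if "r \<in> {s..t}" for r
      using int[OF that] by (simp add: c_def sum_distrib_left distrib_left lc EL[OF that])
    have shift: "((\<lambda>r. S (r - s) (h i)) has_vector_derivative S (r - s) (k i)) (at r within {s..t})"
      if "i \<in> I" "r \<in> {s..t}" for i r
    proof -
      have "((\<lambda>r. r - s) has_vector_derivative 1) (at r within {s..t})"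
        by (auto intro!: derivative_eq_intros)
      moreover have "((\<lambda>r. S r (h i)) has_vector_derivative S (r - s) (k i)) (at (r - s) within (\<lambda>r. r - s) ` {s..t})"
        using has_vector_derivative_semigroup[OF gen[OF that(1)], of "r - s"] that(2)
        by (auto intro: has_vector_derivative_within_subset)
      ultimately show ?thesis
        using vector_diff_chain_within[of "\<lambda>r. r - s" 1 r "{s..t}" "\<lambda>r. S r (h i)"] by (simp add: o_def)
    qed
    have contS: "continuous_on {s..t} (\<lambda>r. S (r - s) f)" for f
      by (rule continuous_on_compose2[OF continuous_on_semigroup]) (auto intro!: continuous_intros)
    have "(?\<phi> has_vector_derivative ?\<psi> r) (at r within {s..t})" if r: "s \<le> r" "r \<le> t" for r
      unfolding has_real_derivative_iff_has_vector_derivative[symmetric]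
    proof (rule DERIV_sum)
      fix i assume i: "i \<in> I"
      have "((\<lambda>r. L (S (r - s) (h i))) has_real_derivative L (S (r - s) (k i))) (at r within {s..t})"
        unfolding has_real_derivative_iff_has_vector_derivative
        using r by (intro L.has_vector_derivative shift i) auto
      moreover have "(g i has_real_derivative g' i r) (at r within {s..t})"
        using r st by (intro has_field_derivative_subset[OF deriv[OF i]]) auto
      ultimately show "((\<lambda>r. g i r * L (S (r - s) (h i))) has_real_derivative
          g' i r * L (S (r - s) (h i)) + g i r * L (S (r - s) (k i))) (at r within {s..t})"
        by (auto intro!: derivative_eq_intros)
    qed
    moreover have "continuous_on {s..t} ?\<psi>"
      using st
      by (intro continuous_intros L.continuous_on contS
          continuous_on_subset[OF contg] continuous_on_subset[OF cont]) auto
    ultimately have "(\<integral>r. indicator {s..t} r *\<^sub>R ?\<psi> r \<partial>lborel) = ?\<phi> t - ?\<phi> s"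
      by (intro integral_FTC_Icc st(2)) auto
    also have "\<dots> = (\<integral>\<omega>. Z \<omega> * U t \<omega> \<partial>M) - (\<integral>\<omega>. Z \<omega> * U s \<omega> \<partial>M)"
      using st by (simp only: EU[of t] EU[of s] atLeastAtMost_iff order_refl)
    also have "(\<integral>r. indicator {s..t} r *\<^sub>R ?\<psi> r \<partial>lborel) = (LBINT r:{s..t}. (\<integral>\<omega>. Z \<omega> * c r \<omega> \<partial>M))"
      unfolding set_lebesgue_integral_def
      by (intro Bochner_Integration.integral_cong) (auto simp: Ec indicator_def)
    finally show ?thesis by (rule sym)
  qed
  let ?X = "\<lambda>t \<omega>. U t \<omega> - U 0 \<omega> - (LBINT s:{0..t}. c s \<omega>)"
  have rcX: "rc_process ?X" if "T \<ge> 0" by (rule rc_process_shifted_integral[OF U c that])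
  show "martingale_on T M F ?X"
    unfolding martingale_on_def
  proof (intro conjI ballI allI impI)
    fix t assume t: "t \<in> {0..T}"
    then have "T \<ge> 0" by simp
    show "subalgebra M (F t)" using t by (rule subalg)
    show "?X t \<in> borel_measurable (F t)" by (rule rc_adapted[OF rcX t]) fact
    show "integrable M (?X t)" by (rule rc_integrable[OF rcX t]) fact
  next
    fix s t :: real assume st': "0 \<le> s \<and> s \<le> t \<and> t \<le> T"
    then have st: "0 \<le> s" "s \<le> t" "t \<le> T" and ts: "s \<in> {0..T}" "t \<in> {0..T}" and T: "T \<ge> 0" by auto
    show "sets (F s) \<subseteq> sets (F t)" using st by (rule filt_mono)
    interpret sigma_finite_subalgebra M "F s" by (rule sigma_finite_filt[OF ts(1)])
    show "AE \<omega> in M. real_cond_exp M (F s) (?X t) \<omega> = ?X s \<omega>"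
    proof (rule real_cond_exp_charact)
      fix A assume A: "A \<in> sets (F s)"
      \<comment> \<open>Conditional expectations are characterised by integrals over events of
        \<open>F s\<close>, so indicators are the only weights to be tested.\<close>
      define Z :: "'w \<Rightarrow> real" where "Z = indicator A"
      have Z: "Z \<in> borel_measurable (F s)" "\<And>\<omega>. \<omega> \<in> space M \<Longrightarrow> \<bar>Z \<omega>\<bar> \<le> 1"
        using A by (auto simp: Z_def indicator_def)
      have ZM: "Z \<in> borel_measurable M"
        using Z(1) by (rule measurable_from_subalg[OF subalg])
      let ?q = "\<lambda>r. \<integral>\<omega>. Z \<omega> * c r \<omega> \<partial>M"
      have q: "set_integrable lborel {0..t} ?q"
        by (rule rc_expectation_integrable[OF c ts(2) ZM Z(2)])
      have EX: "(\<integral>\<omega>. Z \<omega> * ?X r \<omega> \<partial>M) =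
          (\<integral>\<omega>. Z \<omega> * U r \<omega> \<partial>M) - (\<integral>\<omega>. Z \<omega> * U 0 \<omega> \<partial>M) - (LBINT s:{0..r}. ?q s)"
        if r: "r \<in> {0..T}" for r
        using rc_integral_expectation[OF c r ZM Z(2)] rc_mult_integrable[OF U r ZM Z(2)]
          rc_mult_integrable[OF rc_process_initial[OF U T] r ZM Z(2)]
          rc_mult_integrable[OF rc_process_integral[OF c] r ZM Z(2)]
        by (simp add: right_diff_distrib)
      \<comment> \<open>The expectations of \<open>Z * ?X t\<close> and \<open>Z * ?X s\<close>
        differ by that of \<open>Z * (U t - U s)\<close> minus the integral of \<open>?q\<close>
        over [s, t], which \<open>key\<close> shows to be zero. The two closed intervals share only
        the null point \<open>s\<close>.\<close>
      have "(LBINT r:{0..t}. ?q r) = (LBINT r:{0..s} \<union> {s..t}. ?q r)"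
        using st by (simp add: ivl_disj_un_two_touch)
      also have "\<dots> = (LBINT r:{0..s}. ?q r) + (LBINT r:{s..t}. ?q r)"
      proof (rule set_integral_Un_AE)
        show "AE r in lborel. \<not> (r \<in> {0..s} \<and> r \<in> {s..t})"
          using AE_lborel_singleton[of s] by eventually_elim auto
        show "set_integrable lborel {0..s} ?q" "set_integrable lborel {s..t} ?q"
          using st by (auto intro!: set_integrable_subset[OF q])
      qed auto
      also have "(LBINT r:{s..t}. ?q r) = (\<integral>\<omega>. Z \<omega> * U t \<omega> \<partial>M) - (\<integral>\<omega>. Z \<omega> * U s \<omega> \<partial>M)"
        by (rule key[OF st Z, symmetric])
      finally show "set_lebesgue_integral M A (?X t) = set_lebesgue_integral M A (?X s)"
        using EX[OF ts(1)] EX[OF ts(2)] by (simp add: set_lebesgue_integral_def Z_def)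
    qed (use rcX[OF T] rc_integrable[OF rcX[OF T]] rc_adapted[OF rcX[OF T]] ts in auto)
  qed
qed


text \<open>The square of U is again a finite combination of the same kind, indexed by pairs and
  built on the products \<open>hh i j\<close>. A product of functions in the domain of a generator
  need not lie in the domain, so \<open>gen2\<close> asks for this separately.\<close>

theorem dynkin_second_moment:
  fixes h k :: "'i \<Rightarrow> 'a \<Rightarrow>\<^sub>C real" and hh kk :: "'i \<Rightarrow> 'i \<Rightarrow> 'a \<Rightarrow>\<^sub>C real" and g g' :: "'i \<Rightarrow> real \<Rightarrow> real"
  assumes gen: "\<And>i. i \<in> I \<Longrightarrow> (h i, k i) \<in> generator_graph S"
    and gen2: "\<And>i j. i \<in> I \<Longrightarrow> j \<in> I \<Longrightarrow> (hh i j, kk i j) \<in> generator_graph S"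
    and hh: "\<And>i j x. i \<in> I \<Longrightarrow> j \<in> I \<Longrightarrow> apply_bcontfun (hh i j) x = apply_bcontfun (h i) x * apply_bcontfun (h j) x"
    and deriv: "\<And>i t. i \<in> I \<Longrightarrow> t \<in> {0..T} \<Longrightarrow> (g i has_real_derivative g' i t) (at t within {0..})"
    and cont: "\<And>i. i \<in> I \<Longrightarrow> continuous_on {0..T} (g' i)"
  defines "U \<equiv> \<lambda>t \<omega>. \<Sum>i\<in>I. g i t * apply_bcontfun (h i) (X t \<omega>)"
    and "c \<equiv> \<lambda>t \<omega>. \<Sum>i\<in>I. g' i t * apply_bcontfun (h i) (X t \<omega>) + g i t * apply_bcontfun (k i) (X t \<omega>)"
    and "\<Gamma> \<equiv> \<lambda>t \<omega>. (\<Sum>i\<in>I. \<Sum>j\<in>I. g i t * g j t * apply_bcontfun (kk i j) (X t \<omega>))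
      - 2 * (\<Sum>i\<in>I. g i t * apply_bcontfun (h i) (X t \<omega>)) * (\<Sum>i\<in>I. g i t * apply_bcontfun (k i) (X t \<omega>))"
  shows rc_process_carre_du_champ: "rc_process \<Gamma>"
    and second_moment_carre_du_champ: "t \<in> {0..T} \<Longrightarrow>
      (\<integral>\<omega>. (U t \<omega> - U 0 \<omega> - (LBINT s:{0..t}. c s \<omega>))\<^sup>2 \<partial>M) = (\<integral>\<omega>. (LBINT s:{0..t}. \<Gamma> s \<omega>) \<partial>M)"
proof -
  have first: "rc_process U" "rc_process c"
      "martingale_on T M F (\<lambda>t \<omega>. U t \<omega> - U 0 \<omega> - (LBINT s:{0..t}. c s \<omega>))"
    unfolding U_def c_def by (rule dynkin_martingale; (fact gen deriv cont)?)+
  define d where "d = (\<lambda>t \<omega>. \<Sum>p\<in>I \<times> I.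
    (g' (fst p) t * g (snd p) t + g (fst p) t * g' (snd p) t) * apply_bcontfun (hh (fst p) (snd p)) (X t \<omega>)
    + g (fst p) t * g (snd p) t * apply_bcontfun (kk (fst p) (snd p)) (X t \<omega>))"
  have contg: "continuous_on {0..T} (g i)" if "i \<in> I" for i
    using deriv[OF that] has_field_derivative_subset[of "g i" _ _ "{0..}" "{0..T}"]
    by (intro DERIV_continuous_on[where D = "g' i"]) auto
  have UU: "(\<Sum>p\<in>I \<times> I. g (fst p) t * g (snd p) t * apply_bcontfun (hh (fst p) (snd p)) (X t \<omega>)) = (U t \<omega>)\<^sup>2" for t \<omega>
    by (simp add: U_def power2_eq_square sum_product sum.cartesian_product' hh mult_ac)
  have deriv2: "((\<lambda>t. g (fst p) t * g (snd p) t) has_real_derivative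
      g' (fst p) t * g (snd p) t + g (fst p) t * g' (snd p) t) (at t within {0..})"
    if "p \<in> I \<times> I" "t \<in> {0..T}" for p t
    using that by (auto intro!: derivative_eq_intros deriv)
  have gen2': "(hh (fst p) (snd p), kk (fst p) (snd p)) \<in> generator_graph S" if "p \<in> I \<times> I" for p
    using that gen2 by auto
  have cont2: "continuous_on {0..T} (\<lambda>t. g' (fst p) t * g (snd p) t + g (fst p) t * g' (snd p) t)"
    if "p \<in> I \<times> I" for p
    using that by (auto intro!: continuous_intros cont contg)
  have second: "rc_process d"
      "martingale_on T M F (\<lambda>t \<omega>. (U t \<omega>)\<^sup>2 - (U 0 \<omega>)\<^sup>2 - (LBINT s:{0..t}. d s \<omega>))"
    unfolding UU[symmetric] d_def by (rule dynkin_martingale; (fact gen2' deriv2 cont2)?)+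
  \<comment> \<open>The time derivatives contribute twice \<open>U\<close> times the differentiated
    sum to \<open>d\<close>, which is exactly their contribution to \<open>2 * U * c\<close>. Only
    the generator terms survive.\<close>
  have \<Gamma>: "d t \<omega> - 2 * U t \<omega> * c t \<omega> = \<Gamma> t \<omega>" for t \<omega>
  proof -
    have "d t \<omega> = (\<Sum>i\<in>I. \<Sum>j\<in>I. (g' i t * h i (X t \<omega>)) * (g j t * h j (X t \<omega>)))
        + (\<Sum>i\<in>I. \<Sum>j\<in>I. (g i t * h i (X t \<omega>)) * (g' j t * h j (X t \<omega>)))
        + (\<Sum>i\<in>I. \<Sum>j\<in>I. g i t * g j t * kk i j (X t \<omega>))"
      unfolding d_def sum.cartesian_product' sum.distrib[symmetric]
      by (intro sum.cong) (simp_all add: hh algebra_simps)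
    also have "\<dots> = 2 * U t \<omega> * (\<Sum>i\<in>I. g' i t * h i (X t \<omega>))
        + (\<Sum>i\<in>I. \<Sum>j\<in>I. g i t * g j t * kk i j (X t \<omega>))"
      by (simp add: U_def sum_product[symmetric])
    finally show ?thesis
      by (simp add: \<Gamma>_def c_def sum.distrib U_def algebra_simps)
  qed
  show "rc_process \<Gamma>"
    unfolding \<Gamma>[symmetric, abs_def] mult.assoc
    by (intro rc_process_diff rc_process_cmult rc_process_mult first second)
  show "(\<integral>\<omega>. (U t \<omega> - U 0 \<omega> - (LBINT s:{0..t}. c s \<omega>))\<^sup>2 \<partial>M) = (\<integral>\<omega>. (LBINT s:{0..t}. \<Gamma> s \<omega>) \<partial>M)"
    if "t \<in> {0..T}"
    using martingale_second_moment[OF first(1,2) second(1) first(3) second(2) that] by (simp add: \<Gamma>)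
qed

end

section \<open>The exclusion generator and its test functions\<close>

lemma finite_vec_range:
  assumes "finite (B :: 'a set)"
  shows "finite {x :: 'a ^ 'd::finite. \<forall>i. x $ i \<in> B}"
proof (rule finite_subset)
  show "{x. \<forall>i. x $ i \<in> B} \<subseteq> vec_lambda ` (PiE UNIV (\<lambda>_::'d. B))"
  proof
    fix x :: "'a ^ 'd" assume "x \<in> {x. \<forall>i. x $ i \<in> B}"
    then have "vec_nth x \<in> PiE UNIV (\<lambda>_. B)" by auto
    then show "x \<in> vec_lambda ` (PiE UNIV (\<lambda>_. B))"
      by (intro image_eqI[of _ _ "vec_nth x"]) simp_all
  qed
  show "finite (vec_lambda ` (PiE UNIV (\<lambda>_::'d. B)))"
    using assms by (intro finite_imageI finite_PiE) auto
qed

text \<open>A product of Borel sigma-algebras over countably many coordinates is the Borel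
  sigma-algebra of the product when the factors are second countable. Here this identifies the
  measurable structure of \<open>config_space\<close> with its product topology.\<close>

instance bool :: second_countable_topology
proof
  show "\<exists>B::bool set set. countable B \<and> open = generate_topology B"
    by (intro exI[of _ "range lessThan \<union> range greaterThan"]) (simp add: open_bool_def countable_finite fun_eq_iff)
qed

lemma sets_config_space: "sets (config_space :: ('d::finite) config measure) = sets borel"
proof -
  have "sets (config_space :: 'd config measure) = sets (PiM UNIV (\<lambda>_. borel))"
    by (intro sets_PiM_cong refl sets_borel_eq_count_space[symmetric])
  also have "\<dots> = sets borel" by (rule sets_PiM_equal_borel)
  finally show ?thesis .
qed

lemma local_fun_mult:
  assumes "local_fun f" "local_fun g"
  shows "local_fun (\<lambda>\<eta>. f \<eta> * g \<eta>)"
proof -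
  obtain A where A: "finite A" "\<forall>\<eta> \<xi>. (\<forall>x\<in>A. \<eta> x = \<xi> x) \<longrightarrow> f \<eta> = f \<xi>"
    using assms(1) unfolding local_fun_def by blast
  obtain B where B: "finite B" "\<forall>\<eta> \<xi>. (\<forall>x\<in>B. \<eta> x = \<xi> x) \<longrightarrow> g \<eta> = g \<xi>"
    using assms(2) unfolding local_fun_def by blast
  have "f \<eta> * g \<eta> = f \<xi> * g \<xi>" if "\<forall>x\<in>A \<union> B. \<eta> x = \<xi> x" for \<eta> \<xi>
    using A(2)[rule_format, of \<eta> \<xi>] B(2)[rule_format, of \<eta> \<xi>] that by simp
  then show ?thesis
    unfolding local_fun_def using A(1) B(1) by (intro exI[of _ "A \<union> B"]) simp
qed

lemma local_fun_occupation: "local_fun (\<lambda>\<eta>. of_bool (\<eta> x))"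
  unfolding local_fun_def by (intro exI[of _ "{x}"]) simp

text \<open>Such a function is locally constant, since prescribing the finitely many coordinates in
  A defines an open set, and it takes finitely many values.\<close>

lemma local_fun_bcontfun:
  assumes "local_fun (f :: 'd config \<Rightarrow> real)"
  shows "f \<in> bcontfun"
proof -
  obtain A where A: "finite A" "\<And>\<eta> \<xi>. (\<forall>x\<in>A. \<eta> x = \<xi> x) \<Longrightarrow> f \<eta> = f \<xi>"
    using assms unfolding local_fun_def by blast
  have "(f \<longlongrightarrow> f \<eta>) (at \<eta>)" for \<eta>
  proof (rule tendsto_eventually)
    have "open (\<Inter>x\<in>A. (\<lambda>\<xi>. \<xi> x) -` {\<eta> x})"
      by (intro open_INT A(1) ballI open_vimage Topological_Spaces.open_discrete
          continuous_on_product_coordinates)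
    then have "\<forall>\<^sub>F \<xi> in at \<eta>. \<xi> \<in> (\<Inter>x\<in>A. (\<lambda>\<xi>. \<xi> x) -` {\<eta> x})"
      by (intro eventually_at_topological[THEN iffD2] exI conjI) auto
    then show "\<forall>\<^sub>F \<xi> in at \<eta>. f \<xi> = f \<eta>"
      by eventually_elim (auto intro: A(2))
  qed
  then have "continuous_on UNIV f"
    by (simp add: continuous_on_def)
  moreover have "range f \<subseteq> f ` (\<lambda>B x. x \<in> B) ` Pow A"
  proof
    fix y assume "y \<in> range f"
    then obtain \<eta> where "y = f \<eta>" by blast
    \<comment> \<open>Emptying all sites outside A does not change the value of \<open>f\<close>, so
      the subsets of A already produce every value.\<close>
    moreover have "f \<eta> = f (\<lambda>x. x \<in> {x\<in>A. \<eta> x})" by (intro A(2)) simp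
    ultimately show "y \<in> f ` (\<lambda>B x. x \<in> B) ` Pow A" by blast
  qed
  then have "bounded (range f)"
    using A(1) by (intro finite_imp_bounded) (simp add: finite_subset[OF _ finite_imageI])
  ultimately show ?thesis by (simp add: bcontfun_def)
qed

section \<open>The exclusion generator on local functions: convergence, linearity and
  continuity\<close>

lemma jump_weight_nonneg: "jump_weight \<gamma> x \<ge> 0"
  by (simp add: jump_weight_def)

lemma trans_prob_nonneg: "trans_prob \<gamma> x \<ge> 0"
  unfolding trans_prob_def by (intro mult_nonneg_nonneg divide_nonneg_nonneg infsum_nonneg jump_weight_nonneg) auto

text \<open>If the weights were not summable, their \<open>infsum\<close> would be \<open>0\<close> and \<open>trans_prob\<close> would
  vanish, so that no estimate on the weights is needed.\<close>

lemma trans_prob_summable: "trans_prob \<gamma> summable_on UNIV"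
proof (cases "jump_weight \<gamma> summable_on (UNIV :: (int ^ 'a) set)")
  case True
  then show ?thesis
    unfolding trans_prob_def by (rule summable_on_cmult_right)
next
  case False
  then show ?thesis
    by (simp add: trans_prob_def[abs_def] infsum_not_exists)
qed

definition jump_rate :: "'d::finite \<Rightarrow> real \<Rightarrow> real \<Rightarrow> real \<Rightarrow> nat \<Rightarrow> (int ^ 'd) \<times> (int ^ 'd) \<Rightarrow> real" where
  "jump_rate l \<gamma> \<alpha> \<beta> n p = trans_prob \<gamma> (snd p - fst p) * bond_rate l \<alpha> \<beta> n (fst p) (snd p)"

lemma excl_gen_jump_rate:
  "excl_gen l \<gamma> \<alpha> \<beta> n f \<eta> =
    1/2 * (\<Sum>\<^sub>\<infinity>p\<in>UNIV. jump_rate l \<gamma> \<alpha> \<beta> n p * (f (exchange (fst p) (snd p) \<eta>) - f \<eta>))"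
  by (simp add: excl_gen_def jump_rate_def case_prod_beta')

text \<open>With one endpoint fixed, the displacement runs bijectively through the lattice, so each
  row carries the total mass of \<open>trans_prob\<close>; a finite set A gives finitely many rows.
  These are the bonds that a local function can see.\<close>

lemma trans_prob_summable_rows:
  assumes "finite A"
  shows "(\<lambda>p. trans_prob \<gamma> (snd p - fst p)) summable_on (A \<times> UNIV)"
    and "(\<lambda>p. trans_prob \<gamma> (snd p - fst p)) summable_on (UNIV \<times> A)"
proof -
  have bij: "bij (\<lambda>y. y - x)" "bij (\<lambda>y. x - y)" for x :: "int ^ 'a"
    by (rule bij_betwI[of _ _ _ "\<lambda>y. y + x"], simp_all)
      (rule bij_betwI[of _ _ _ "\<lambda>y. x - y"], simp_all)
  have 1: "(\<lambda>y. trans_prob \<gamma> (y - x)) summable_on UNIV"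
    and 2: "(\<lambda>y. trans_prob \<gamma> (x - y)) summable_on UNIV" for x :: "int ^ 'a"
    using summable_on_reindex_bij_betw[OF bij(1), of "trans_prob \<gamma>"]
      summable_on_reindex_bij_betw[OF bij(2), of "trans_prob \<gamma>"] trans_prob_summable by blast+
  show "(\<lambda>p. trans_prob \<gamma> (snd p - fst p)) summable_on (A \<times> UNIV)"
    by (rule summable_on_SigmaI[where g = "\<lambda>x. \<Sum>\<^sub>\<infinity>y. trans_prob \<gamma> (y - x)"])
      (use assms 1 in \<open>auto intro: trans_prob_nonneg\<close>)
  show "(\<lambda>p. trans_prob \<gamma> (snd p - fst p)) summable_on (UNIV \<times> A)"
    unfolding summable_on_swap[of _ UNIV A] case_prod_beta'
    by (rule summable_on_SigmaI[where g = "\<lambda>x. \<Sum>\<^sub>\<infinity>y. trans_prob \<gamma> (x - y)"])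
      (use assms 2 in \<open>auto intro: trans_prob_nonneg\<close>)
qed

text \<open>An exchange can change \<open>f\<close> only if it touches the finite set A on which
  \<open>f\<close> depends. Such a bond contributes at most its jump probability times a constant,
  namely a bound on the bond rates times twice a bound for \<open>f\<close>. The majorant is the
  same for all configurations, which serves for convergence and for continuity alike.\<close>

lemma excl_gen_dominated:
  fixes f :: "'d::finite config \<Rightarrow> real"
  assumes "local_fun f"
  obtains W where "W summable_on UNIV"
    "\<And>p \<eta>. \<bar>jump_rate l \<gamma> \<alpha> \<beta> n p * (f (exchange (fst p) (snd p) \<eta>) - f \<eta>)\<bar> \<le> W p"
proof -
  obtain A where A: "finite A" "\<And>\<eta> \<xi>. (\<forall>x\<in>A. \<eta> x = \<xi> x) \<Longrightarrow> f \<eta> = f \<xi>"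
    using assms unfolding local_fun_def by blast
  have "bounded (range f)"
    using local_fun_bcontfun[OF assms] by (simp add: bcontfun_def)
  then obtain K where K: "K > 0" "\<And>\<eta>. \<bar>f \<eta>\<bar> \<le> K"
    unfolding bounded_pos by auto
  \<comment> \<open>Dominates both possible bond rates, the 1 of an ordinary bond and the value at a
    slow one.\<close>
  define R where "R = 1 + \<bar>\<alpha> * real n powr (- \<beta>)\<bar>"
  define P where "P = A \<times> UNIV \<union> UNIV \<times> A"
  define W where "W = (\<lambda>p :: (int ^ 'd) \<times> (int ^ 'd). (if p \<in> P then (R * (2 * K)) * trans_prob \<gamma> (snd p - fst p) else 0))"
  have "(\<lambda>p. (R * (2 * K)) * trans_prob \<gamma> (snd p - fst p)) summable_on P"
    unfolding P_def by (intro summable_on_cmult_right summable_on_union trans_prob_summable_rows A(1))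
  then have "W summable_on UNIV"
    by (subst summable_on_cong_neutral[where g = "\<lambda>p. (R * (2 * K)) * trans_prob \<gamma> (snd p - fst p)" and T = P])
      (auto simp: W_def)
  moreover have "\<bar>jump_rate l \<gamma> \<alpha> \<beta> n p * (f (exchange (fst p) (snd p) \<eta>) - f \<eta>)\<bar> \<le> W p" for p \<eta>
  proof (cases "p \<in> P")
    case True
    have "\<bar>bond_rate l \<alpha> \<beta> n (fst p) (snd p)\<bar> \<le> R"
      by (simp add: bond_rate_def R_def)
    moreover have "\<bar>f (exchange (fst p) (snd p) \<eta>) - f \<eta>\<bar> \<le> 2 * K"
      using K(2)[of \<eta>] K(2)[of "exchange (fst p) (snd p) \<eta>"] by linarith
    ultimately have "\<bar>bond_rate l \<alpha> \<beta> n (fst p) (snd p)\<bar> * \<bar>f (exchange (fst p) (snd p) \<eta>) - f \<eta>\<bar> \<le> R * (2 * K)"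
      by (intro mult_mono') auto
    then have "trans_prob \<gamma> (snd p - fst p) * (\<bar>bond_rate l \<alpha> \<beta> n (fst p) (snd p)\<bar> * \<bar>f (exchange (fst p) (snd p) \<eta>) - f \<eta>\<bar>)
        \<le> trans_prob \<gamma> (snd p - fst p) * (R * (2 * K))"
      by (intro mult_left_mono trans_prob_nonneg)
    then show ?thesis
      using True trans_prob_nonneg[of \<gamma> "snd p - fst p"] by (simp add: W_def jump_rate_def abs_mult mult_ac)
  next
    case False
    then have "f (exchange (fst p) (snd p) \<eta>) = f \<eta>"
      by (intro A(2)) (auto simp: P_def exchange_def mem_Times_iff)
    then show ?thesis using False by (simp add: W_def)
  qed
  ultimately show ?thesis by (rule that)
qed

lemma excl_gen_summable:
  assumes "local_fun f"
  shows "(\<lambda>p. jump_rate l \<gamma> \<alpha> \<beta> n p * (f (exchange (fst p) (snd p) \<eta>) - f \<eta>)) summable_on UNIV"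
proof -
  obtain W where W: "W summable_on UNIV"
    "\<And>p \<eta>. \<bar>jump_rate l \<gamma> \<alpha> \<beta> n p * (f (exchange (fst p) (snd p) \<eta>) - f \<eta>)\<bar> \<le> W p"
    using excl_gen_dominated[OF assms, of l \<gamma> \<alpha> \<beta> n] by blast
  show ?thesis
    by (rule abs_summable_summable, rule summable_on_comparison_test[OF W(1)]) (use W(2) in auto)
qed

text \<open>\<open>infsum\<close> is additive only on summable families. Locality supplies the
  summability, and the induction is carried out with \<open>has_sum\<close>, which records
  it.\<close>

lemma excl_gen_sum:
  assumes "finite I" "\<And>i. i \<in> I \<Longrightarrow> local_fun (f i)"
  shows "excl_gen l \<gamma> \<alpha> \<beta> n (\<lambda>\<xi>. \<Sum>i\<in>I. a i * f i \<xi>) \<eta> = (\<Sum>i\<in>I. a i * excl_gen l \<gamma> \<alpha> \<beta> n (f i) \<eta>)"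
proof -
  let ?D = "\<lambda>f p. jump_rate l \<gamma> \<alpha> \<beta> n p * (f (exchange (fst p) (snd p) \<eta>) - f \<eta>)"
  have "((\<lambda>p. ?D (\<lambda>\<xi>. \<Sum>i\<in>I. a i * f i \<xi>) p) has_sum (\<Sum>i\<in>I. a i * (\<Sum>\<^sub>\<infinity>p\<in>UNIV. ?D (f i) p))) UNIV"
    using assms
  proof (induction I)
    case empty
    then show ?case by simp
  next
    case (insert j J)
    have "((\<lambda>p. a j * ?D (f j) p) has_sum a j * (\<Sum>\<^sub>\<infinity>p\<in>UNIV. ?D (f j) p)) UNIV"
      using insert.prems by (intro has_sum_cmult_right has_sum_infsum excl_gen_summable) auto
    from has_sum_add[OF this insert.IH] show ?case
      using insert by (simp add: algebra_simps)
  qed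
  from infsumI[OF this] show ?thesis
    by (simp add: excl_gen_jump_rate sum_distrib_left mult.left_commute)
qed

text \<open>Weierstrass M-test: every summand is continuous in the configuration, and the
  configuration-free majorant makes the finite partial sums converge uniformly.\<close>

lemma excl_gen_bcontfun:
  fixes f :: "'d::finite config \<Rightarrow> real"
  assumes "local_fun f"
  shows "excl_gen l \<gamma> \<alpha> \<beta> n f \<in> bcontfun"
proof -
  obtain W where W: "W summable_on UNIV"
    "\<And>p \<eta>. \<bar>jump_rate l \<gamma> \<alpha> \<beta> n p * (f (exchange (fst p) (snd p) \<eta>) - f \<eta>)\<bar> \<le> W p"
    using excl_gen_dominated[OF assms, of l \<gamma> \<alpha> \<beta> n] by blast
  let ?D = "\<lambda>p \<eta>. jump_rate l \<gamma> \<alpha> \<beta> n p * (f (exchange (fst p) (snd p) \<eta>) - f \<eta>)"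
  have contf: "continuous_on UNIV f"
    using local_fun_bcontfun[OF assms] by (simp add: bcontfun_def)
  have exch: "continuous_on UNIV (\<lambda>\<eta> :: 'd config. exchange x y \<eta>)" for x y
  proof (rule continuous_on_coordinatewise_then_product)
    fix z
    \<comment> \<open>Each coordinate of the exchanged configuration is some coordinate of the
      original one, and coordinates are continuous in the product topology.\<close>
    have "(\<lambda>\<eta> :: 'd config. exchange x y \<eta> z) = (\<lambda>\<eta>. \<eta> (if z = y then x else if z = x then y else z))"
      by (auto simp: exchange_def)
    then show "continuous_on UNIV (\<lambda>\<eta> :: 'd config. exchange x y \<eta> z)"
      using continuous_on_product_coordinates by metis
  qed
  have contD: "continuous_on UNIV (?D p)" for p
    by (intro continuous_intros contf continuous_on_compose2[OF contf exch]) auto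
  have "uniform_limit UNIV (\<lambda>Q \<eta>. \<Sum>p\<in>Q. ?D p \<eta>) (\<lambda>\<eta>. \<Sum>\<^sub>\<infinity>p\<in>UNIV. ?D p \<eta>) (finite_subsets_at_top UNIV)"
    by (rule Weierstrass_m_test_general[OF _ W(1)]) (use W(2) in auto)
  then have "continuous_on UNIV (\<lambda>\<eta>. \<Sum>\<^sub>\<infinity>p\<in>UNIV. ?D p \<eta>)"
    by (rule uniform_limit_theorem[rotated])
      (auto intro!: always_eventually continuous_on_sum contD)
  then have "continuous_on UNIV (excl_gen l \<gamma> \<alpha> \<beta> n f)"
    unfolding excl_gen_jump_rate[abs_def] by (intro continuous_intros)
  moreover have "norm (excl_gen l \<gamma> \<alpha> \<beta> n f \<eta>) \<le> 1/2 * (\<Sum>\<^sub>\<infinity>p\<in>UNIV. W p)" for \<eta>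
  proof -
    have "norm (\<Sum>\<^sub>\<infinity>p\<in>UNIV. ?D p \<eta>) \<le> (\<Sum>\<^sub>\<infinity>p\<in>UNIV. W p)"
      by (rule norm_infsum_le[OF has_sum_infsum has_sum_infsum])
        (use W excl_gen_summable[OF assms] in auto)
    then show ?thesis by (simp add: excl_gen_jump_rate)
  qed
  ultimately show ?thesis by (rule bcontfun_normI)
qed

text \<open>\<open>Bcontfun\<close> can be undone only on bounded continuous functions. The
  continuity of the generator image is thus what admits a local function, together with that image,
  to the pregenerator graph.\<close>

lemma excl_pregenerator_graphI:
  assumes "local_fun f"
  shows "(Bcontfun f, Bcontfun (\<lambda>\<eta>. time_scale \<gamma> n * excl_gen l \<gamma> \<alpha> \<beta> n f \<eta>))
      \<in> excl_pregenerator_graph l \<gamma> \<alpha> \<beta> n"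
    and "apply_bcontfun (Bcontfun (\<lambda>\<eta>. time_scale \<gamma> n * excl_gen l \<gamma> \<alpha> \<beta> n f \<eta>)) \<eta>
      = time_scale \<gamma> n * excl_gen l \<gamma> \<alpha> \<beta> n f \<eta>"
proof -
  have "(\<lambda>\<eta>. time_scale \<gamma> n * excl_gen l \<gamma> \<alpha> \<beta> n f \<eta>) \<in> bcontfun"
    using scaleR_cont[OF excl_gen_bcontfun[OF assms]] by simp
  note inv = Bcontfun_inverse[OF this] Bcontfun_inverse[OF local_fun_bcontfun[OF assms]]
  show "(Bcontfun f, Bcontfun (\<lambda>\<eta>. time_scale \<gamma> n * excl_gen l \<gamma> \<alpha> \<beta> n f \<eta>))
      \<in> excl_pregenerator_graph l \<gamma> \<alpha> \<beta> n"
    using assms by (simp add: excl_pregenerator_graph_def inv)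
  show "apply_bcontfun (Bcontfun (\<lambda>\<eta>. time_scale \<gamma> n * excl_gen l \<gamma> \<alpha> \<beta> n f \<eta>)) \<eta>
      = time_scale \<gamma> n * excl_gen l \<gamma> \<alpha> \<beta> n f \<eta>"
    by (simp add: inv)
qed


section \<open>Test functions: time derivatives, supports, and the empirical measure as a finite
  sum\<close>

lemma S_DifE:
  assumes "G \<in> S_Dif"
  obtains B Gt where "\<And>s u. s \<ge> 0 \<Longrightarrow> G s u \<noteq> 0 \<Longrightarrow> norm u \<le> B"
    "\<And>u. continuous_on {0..} (\<lambda>s. Gt s u)"
    "\<And>s u. s \<ge> 0 \<Longrightarrow> ((\<lambda>r. G r u) has_real_derivative Gt s u) (at s within {0..})"
proof -
  have "compact (closure {(s, u). 0 \<le> s \<and> G s u \<noteq> 0})"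
    using assms by (simp add: S_Dif_def)
  then have "bounded {(s, u). 0 \<le> s \<and> G s u \<noteq> 0}"
    using bounded_subset[OF compact_imp_bounded closure_subset] by blast
  then obtain B where B: "\<forall>p\<in>{(s, u). 0 \<le> s \<and> G s u \<noteq> 0}. norm p \<le> B"
    unfolding bounded_iff by blast
  have supp: "norm u \<le> B" if "s \<ge> 0" "G s u \<noteq> 0" for s u
  proof -
    have "norm u \<le> norm (s, u)" by (rule norm_snd_le)
    also have "\<dots> \<le> B" using B that by blast
    finally show ?thesis .
  qed
  have "\<exists>Gt. continuous_on ({0..} \<times> UNIV) (\<lambda>(s, u). Gt s u) \<and>
      (\<forall>s\<ge>0. \<forall>u. ((\<lambda>r. G r u) has_real_derivative Gt s u) (at s within {0..}))"
    using assms by (simp add: S_Dif_def)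
  then obtain Gt where cont: "continuous_on ({0..} \<times> UNIV) (\<lambda>(s, u). Gt s u)"
    and deriv: "\<And>s u. s \<ge> 0 \<Longrightarrow> ((\<lambda>r. G r u) has_real_derivative Gt s u) (at s within {0..})"
    by blast
  have "continuous_on {0..} (\<lambda>s. Gt s u)" for u
  proof -
    have "continuous_on {0..} (\<lambda>s. case (s, u) of (s, u) \<Rightarrow> Gt s u)"
      by (rule continuous_on_compose2[OF cont]) (auto intro!: continuous_intros)
    then show ?thesis by simp
  qed
  from that[OF supp this deriv] show ?thesis .
qed

text \<open>Every \<open>s\<close> \<ge> 0, including 0, is a limit point of \<open>{0..}\<close>,
  so the derivative within this set is unique. Agreement of \<open>G\<close> and \<open>f\<close> at
  nonnegative times is enough, whatever \<open>G\<close> does before time 0.\<close>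

lemma time_deriv_eq:
  assumes "s \<ge> 0" and "(f has_real_derivative D) (at s within {0..})"
    and "\<And>r. r \<ge> 0 \<Longrightarrow> G r u = f r"
  shows "((\<lambda>r. G r u) has_real_derivative D) (at s within {0..})" and "time_deriv G s u = D"
proof -
  show der: "((\<lambda>r. G r u) has_real_derivative D) (at s within {0..})"
    using assms by (intro has_field_derivative_transform_within[OF assms(2), of 1]) auto
  have "at s within {0..} \<noteq> bot"
    using at_le[of "{s<..}" "{0..}" s] assms(1) trivial_limit_at_right_real[of s]
    by (metis atLeast_iff bot_unique greaterThan_iff less_eq_real_def order_trans subsetI)
  then show "time_deriv G s u = D"
    unfolding time_deriv_def
    using der by (intro vector_derivative_within) (simp_all add: has_real_derivative_iff_has_vector_derivative)
qed

text \<open>For a fixed point u the side of the barrier does not change with time, so only one of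
  the two smooth halves is seen. The discontinuity in space leaves the regularity in time
  intact.\<close>

lemma
  assumes "G \<in> S_Disc l"
  shows S_Disc_has_time_deriv:
      "s \<ge> 0 \<Longrightarrow> ((\<lambda>r. G r u) has_real_derivative time_deriv G s u) (at s within {0..})"
    and S_Disc_continuous_time_deriv: "continuous_on {0..} (\<lambda>s. time_deriv G s u)"
    and S_Disc_bounded_support: "\<exists>B. \<forall>s\<ge>0. \<forall>u. G s u \<noteq> 0 \<longrightarrow> norm u \<le> B"
proof -
  obtain Gm Gp where Gm: "Gm \<in> S_Dif" and Gp: "Gp \<in> S_Dif" and G: "\<And>s u. s \<ge> 0 \<Longrightarrow>
      G s u = indicator {v. v $ l < 0} u * Gm s u + indicator {v. 0 \<le> v $ l} u * Gp s u"
    using assms unfolding S_Disc_def by blast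
  obtain B1 D1 where 1: "\<And>s u. s \<ge> 0 \<Longrightarrow> Gm s u \<noteq> 0 \<Longrightarrow> norm u \<le> B1"
    "\<And>u. continuous_on {0..} (\<lambda>s. D1 s u)"
    "\<And>s u. s \<ge> 0 \<Longrightarrow> ((\<lambda>r. Gm r u) has_real_derivative D1 s u) (at s within {0..})"
    using S_DifE[OF Gm] by blast
  obtain B2 D2 where 2: "\<And>s u. s \<ge> 0 \<Longrightarrow> Gp s u \<noteq> 0 \<Longrightarrow> norm u \<le> B2"
    "\<And>u. continuous_on {0..} (\<lambda>s. D2 s u)"
    "\<And>s u. s \<ge> 0 \<Longrightarrow> ((\<lambda>r. Gp r u) has_real_derivative D2 s u) (at s within {0..})"
    using S_DifE[OF Gp] by blast
  define H where "H = (if u $ l < 0 then Gm else Gp)"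
  define D where "D = (if u $ l < 0 then D1 else D2)"
  have GH: "G r u = H r u" if "r \<ge> 0" for r
    using G[OF that, of u] by (auto simp: H_def indicator_def)
  have der: "((\<lambda>r. H r u) has_real_derivative D s u) (at s within {0..})" if "s \<ge> 0" for s
    using 1(3)[OF that] 2(3)[OF that] by (simp add: H_def D_def)
  note eq = time_deriv_eq[where f = "\<lambda>r. H r u" and G = G and u = u, OF _ der GH]
  show "((\<lambda>r. G r u) has_real_derivative time_deriv G s u) (at s within {0..})" if "s \<ge> 0"
    using eq[OF that that] by simp
  have "continuous_on {0..} (\<lambda>s. D s u)"
    using 1(2) 2(2) by (simp add: D_def)
  then show "continuous_on {0..} (\<lambda>s. time_deriv G s u)"
    by (rule continuous_on_cong[THEN iffD1, rotated -1]) (use eq(2) in auto)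
  have "norm v \<le> max B1 B2" if "s \<ge> 0" "G s v \<noteq> 0" for s v
  proof -
    have "Gm s v \<noteq> 0 \<or> Gp s v \<noteq> 0" using G[OF that(1), of v] that(2) by auto
    then show ?thesis
      using 1(1)[OF that(1), of v] 2(1)[OF that(1), of v] by (auto simp: le_max_iff_disj)
  qed
  then show "\<exists>B. \<forall>s\<ge>0. \<forall>u. G s u \<noteq> 0 \<longrightarrow> norm u \<le> B" by blast
qed

definition site :: "nat \<Rightarrow> int ^ 'd \<Rightarrow> real ^ 'd::finite" where
  "site n x = (\<chi> i. real_of_int (x $ i) / real n)"

text \<open>The set A is the same for all times, so the empirical measure becomes a sum over a fixed
  index set with only its coefficients depending on time.\<close>

lemma S_Disc_finite_sites:
  assumes "G \<in> S_Disc l" "n \<ge> 1"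
  obtains A where "finite A" "\<And>s x. s \<ge> 0 \<Longrightarrow> x \<notin> A \<Longrightarrow> G s (site n x) = 0"
proof -
  obtain B where B: "\<And>s u. s \<ge> 0 \<Longrightarrow> G s u \<noteq> 0 \<Longrightarrow> norm u \<le> B"
    using S_Disc_bounded_support[OF assms(1)] by blast
  \<comment> \<open>If x/n has norm at most B, every coordinate of x is at most B n in absolute
    value.\<close>
  define K where "K = \<lceil>B * real n\<rceil>"
  have "x \<in> {x. \<forall>i. x $ i \<in> {-K..K}}" if "s \<ge> 0" "G s (site n x) \<noteq> 0" for s x
  proof (safe, simp)
    fix i
    have "\<bar>site n x $ i\<bar> \<le> B"
      using component_le_norm_cart[of "site n x" i] B[OF that] by linarith
    then have "\<bar>real_of_int (x $ i)\<bar> \<le> B * real n"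
      using assms(2) by (simp add: site_def field_simps)
    then show "- K \<le> x $ i \<and> x $ i \<le> K"
      unfolding K_def by linarith
  qed
  moreover have "finite {x :: int ^ 'a. \<forall>i. x $ i \<in> {-K..K}}"
    by (rule finite_vec_range) simp
  ultimately show ?thesis using that[of "{x. \<forall>i. x $ i \<in> {-K..K}}"] by blast
qed

lemma emp_finite_sum:
  fixes \<eta> :: "'d::finite config"
  assumes "finite A" "\<And>x. x \<notin> A \<Longrightarrow> g (site n x) = 0"
  shows "emp n \<eta> g = (\<Sum>x\<in>A. g (site n x) / real n ^ CARD('d) * of_bool (\<eta> x))"
proof -
  have "emp n \<eta> g = 1 / real n ^ CARD('d) * (\<Sum>\<^sub>\<infinity>x\<in>UNIV. of_bool (\<eta> x) * g (site n x))"
    by (simp add: emp_def site_def)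
  also have "(\<Sum>\<^sub>\<infinity>x\<in>UNIV. of_bool (\<eta> x) * g (site n x)) = (\<Sum>\<^sub>\<infinity>x\<in>A. of_bool (\<eta> x) * g (site n x))"
    using assms(2) by (intro infsum_cong_neutral) auto
  also have "\<dots> = (\<Sum>x\<in>A. of_bool (\<eta> x) * g (site n x))"
    using assms(1) by (rule infsum_finite)
  finally show ?thesis
    unfolding sum_distrib_left by (elim trans, intro sum.cong refl) simp
qed

theorem proposition3p1:
  fixes l :: "'d::finite"
    and \<gamma> \<alpha> \<beta> T :: real
    and n :: nat
    and \<mu> :: "'d config measure"
    and M :: "'w measure"
    and \<eta> :: "real \<Rightarrow> 'w \<Rightarrow> 'd config"
    and G :: "real \<Rightarrow> real ^ 'd \<Rightarrow> real"
  assumes "T > 0" and "\<gamma> \<ge> 2" and "\<alpha> > 0" and "\<beta> \<ge> 0"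
    and "n \<ge> 1" and "\<gamma> = 2 \<Longrightarrow> n \<ge> 2"
    and "exclusion_process l \<gamma> \<alpha> \<beta> n T \<mu> M \<eta>"
    and "G \<in> S_Disc l"
  shows "martingale_on T M (natural_filtration M config_space \<eta>) (dynkin_mart l \<gamma> \<alpha> \<beta> n \<eta> G) \<and>
    (\<forall>t\<in>{0..T}.
       integrable M (\<lambda>\<omega>. (dynkin_mart l \<gamma> \<alpha> \<beta> n \<eta> G t \<omega>)\<^sup>2) \<and>
       integrable M (carre_du_champ_integral l \<gamma> \<alpha> \<beta> n \<eta> G t) \<and>
       (\<integral>\<omega>. (dynkin_mart l \<gamma> \<alpha> \<beta> n \<eta> G t \<omega>)\<^sup>2 \<partial>M) =
       (\<integral>\<omega>. carre_du_champ_integral l \<gamma> \<alpha> \<beta> n \<eta> G t \<omega> \<partial>M))"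
proof -
  obtain S where proc: "prob_space M" "\<forall>t\<in>{0..T}. \<eta> t \<in> measurable M config_space"
    "\<forall>\<omega>\<in>space M. cadlag_on T (\<lambda>t. \<eta> t \<omega>)"
    and semi: "markov_semigroup S" and graph: "generator_graph S = closure (excl_pregenerator_graph l \<gamma> \<alpha> \<beta> n)"
    and markov: "\<forall>s t f. 0 \<le> s \<and> s \<le> t \<and> t \<le> T \<longrightarrow> (AE \<omega> in M.
      real_cond_exp M (natural_filtration M config_space \<eta> s) (\<lambda>\<omega>. apply_bcontfun f (\<eta> t \<omega>)) \<omega>
        = apply_bcontfun (S (t - s) f) (\<eta> s \<omega>))"
    using assms(7) unfolding exclusion_process_def by blast
  interpret feller_process M S T config_space \<eta>
  proof (intro feller_process.intro feller_process_axioms.intro markov_semigroup_bcontfun.intro)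
    show "((\<lambda>s. \<eta> s \<omega>) \<longlongrightarrow> \<eta> t \<omega>) (at_right t)" if "\<omega> \<in> space M" "t \<in> {0..<T}" for \<omega> t
      using proc(3) that by (simp add: cadlag_on_def)
  qed (use proc semi markov sets_config_space in blast)+
  obtain A where A: "finite A" "\<And>s x. s \<ge> 0 \<Longrightarrow> x \<notin> A \<Longrightarrow> G s (site n x) = 0"
    using S_Disc_finite_sites[OF assms(8,5)] by blast
  define N where "N = real n ^ CARD('d)"
  \<comment> \<open>The index of the abstract theorems is a site x of A. Its coefficient is the test
    function at x/n divided by the volume factor, and its state function is the occupation variable
    of x; \<open>hh\<close> and \<open>kk\<close> are the two-site analogues that the square
    requires.\<close>
  define g where "g = (\<lambda>x s. G s (site n x) / N)"
  define g' where "g' = (\<lambda>x s. time_deriv G s (site n x) / N)"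
  define h where "h = (\<lambda>x. Bcontfun (\<lambda>\<xi> :: 'd config. of_bool (\<xi> x) :: real))"
  define k where "k = (\<lambda>x. Bcontfun (\<lambda>\<xi>. time_scale \<gamma> n * excl_gen l \<gamma> \<alpha> \<beta> n (\<lambda>\<zeta>. of_bool (\<zeta> x)) \<xi>))"
  define hh where "hh = (\<lambda>x y. Bcontfun (\<lambda>\<xi> :: 'd config. of_bool (\<xi> x) * of_bool (\<xi> y) :: real))"
  define kk where "kk = (\<lambda>x y. Bcontfun (\<lambda>\<xi>. time_scale \<gamma> n *
    excl_gen l \<gamma> \<alpha> \<beta> n (\<lambda>\<zeta>. of_bool (\<zeta> x) * of_bool (\<zeta> y)) \<xi>))"
  note loc = local_fun_occupation
  note loc2 = local_fun_mult[OF local_fun_occupation local_fun_occupation]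
  have h: "apply_bcontfun (h x) \<xi> = of_bool (\<xi> x)" for x \<xi>
    unfolding h_def by (subst Bcontfun_inverse[OF local_fun_bcontfun[OF loc]]) simp
  have hh: "apply_bcontfun (hh x y) \<xi> = apply_bcontfun (h x) \<xi> * apply_bcontfun (h y) \<xi>" for x y \<xi>
    unfolding hh_def h by (subst Bcontfun_inverse[OF local_fun_bcontfun[OF loc2]]) simp
  have k: "apply_bcontfun (k x) \<xi> = time_scale \<gamma> n * excl_gen l \<gamma> \<alpha> \<beta> n (\<lambda>\<zeta>. of_bool (\<zeta> x)) \<xi>" for x \<xi>
    unfolding k_def by (rule excl_pregenerator_graphI(2)[OF loc])
  have kk: "apply_bcontfun (kk x y) \<xi> =
      time_scale \<gamma> n * excl_gen l \<gamma> \<alpha> \<beta> n (\<lambda>\<zeta>. of_bool (\<zeta> x) * of_bool (\<zeta> y)) \<xi>" for x y \<xi>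
    unfolding kk_def by (rule excl_pregenerator_graphI(2)[OF loc2])
  have gen: "(h x, k x) \<in> generator_graph S" for x
    unfolding graph h_def k_def using excl_pregenerator_graphI(1)[OF loc] closure_subset by blast
  have gen2: "(hh x y, kk x y) \<in> generator_graph S" for x y
    unfolding graph hh_def kk_def using excl_pregenerator_graphI(1)[OF loc2] closure_subset by blast
  have deriv: "(g x has_real_derivative g' x t) (at t within {0..})" if "t \<in> {0..T}" for x t
    unfolding g_def g'_def using that
    by (intro DERIV_cdivide S_Disc_has_time_deriv[OF assms(8)]) simp
  have cont: "continuous_on {0..T} (g' x)" for x
  proof -
    have "continuous_on {0..T} (\<lambda>s. time_deriv G s (site n x))"
      by (rule continuous_on_subset[OF S_Disc_continuous_time_deriv[OF assms(8)]]) auto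
    then show ?thesis
      unfolding g'_def divide_inverse by (intro continuous_intros)
  qed
  have emp: "emp n \<xi> (G s) = (\<Sum>x\<in>A. g x s * of_bool (\<xi> x))" if "s \<ge> 0" for \<xi> s
    unfolding g_def N_def using A(2)[OF that] by (rule emp_finite_sum[OF A(1)])
  have emp': "emp n \<xi> (time_deriv G s) = (\<Sum>x\<in>A. g' x s * of_bool (\<xi> x))" if "s \<ge> 0" for \<xi> s
    unfolding g'_def N_def
  proof (rule emp_finite_sum[OF A(1)])
    \<comment> \<open>Off A the test function vanishes at all nonnegative times, hence so does its
      time derivative. This uses that A does not depend on time.\<close>
    show "time_deriv G s (site n x) = 0" if "x \<notin> A" for x
      using A(2)[OF _ that] \<open>s \<ge> 0\<close> by (intro time_deriv_eq(2)[where f = "\<lambda>_. 0"]) auto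
  qed
  have Lemp: "time_scale \<gamma> n * excl_gen l \<gamma> \<alpha> \<beta> n (\<lambda>\<xi>. emp n \<xi> (G s)) \<zeta> =
      (\<Sum>x\<in>A. g x s * apply_bcontfun (k x) \<zeta>)" if "s \<ge> 0" for s \<zeta>
    unfolding emp[OF that] excl_gen_sum[OF A(1) loc] k
    by (simp only: sum_distrib_left mult.left_commute)
  have emp2: "(emp n \<xi> (G s))\<^sup>2 = (\<Sum>p\<in>A \<times> A. g (fst p) s * g (snd p) s * (of_bool (\<xi> (fst p)) * of_bool (\<xi> (snd p))))"
    if "s \<ge> 0" for \<xi> s
    unfolding emp[OF that] power2_eq_square sum_product sum.cartesian_product'
    by (intro sum.cong refl) (simp only: fst_conv snd_conv mult_ac)
  have Lemp2: "time_scale \<gamma> n * excl_gen l \<gamma> \<alpha> \<beta> n (\<lambda>\<xi>. (emp n \<xi> (G s))\<^sup>2) \<zeta> =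
      (\<Sum>x\<in>A. \<Sum>y\<in>A. g x s * g y s * apply_bcontfun (kk x y) \<zeta>)" if "s \<ge> 0" for s \<zeta>
    unfolding emp2[OF that] excl_gen_sum[OF finite_cartesian_product[OF A(1) A(1)] loc2]
    unfolding kk sum.cartesian_product' sum_distrib_left
    by (intro sum.cong refl) (simp only: fst_conv snd_conv mult.left_commute)
  define U where "U = (\<lambda>t \<omega>. \<Sum>x\<in>A. g x t * apply_bcontfun (h x) (\<eta> t \<omega>))"
  define c where "c = (\<lambda>t \<omega>. \<Sum>x\<in>A. g' x t * apply_bcontfun (h x) (\<eta> t \<omega>) + g x t * apply_bcontfun (k x) (\<eta> t \<omega>))"
  define \<Gamma> where "\<Gamma> = (\<lambda>t \<omega>. (\<Sum>x\<in>A. \<Sum>y\<in>A. g x t * g y t * apply_bcontfun (kk x y) (\<eta> t \<omega>))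
      - 2 * (\<Sum>x\<in>A. g x t * apply_bcontfun (h x) (\<eta> t \<omega>)) * (\<Sum>x\<in>A. g x t * apply_bcontfun (k x) (\<eta> t \<omega>)))"
  let ?X = "\<lambda>t \<omega>. U t \<omega> - U 0 \<omega> - (LBINT s:{0..t}. c s \<omega>)"
  note dynkin = dynkin_martingale[where I = A and h = h and k = k and g = g and g' = g']
  have U: "rc_process U"
    unfolding U_def by (rule dynkin(1)) (rule gen deriv cont | assumption)+
  have c: "rc_process c"
    unfolding c_def by (rule dynkin(2)) (rule gen deriv cont | assumption)+
  have mart: "martingale_on T M F ?X"
    unfolding U_def c_def by (rule dynkin(3)) (rule gen deriv cont | assumption)+
  note carre = dynkin_second_moment[where I = A and h = h and k = k and hh = hh and kk = kk and g = g and g' = g']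
  have \<Gamma>: "rc_process \<Gamma>"
    unfolding \<Gamma>_def by (rule carre(1)) (rule gen gen2 hh deriv cont | assumption)+
  have second: "(\<integral>\<omega>. (?X t \<omega>)\<^sup>2 \<partial>M) = (\<integral>\<omega>. (LBINT s:{0..t}. \<Gamma> s \<omega>) \<partial>M)" if "t \<in> {0..T}" for t
    unfolding U_def c_def \<Gamma>_def
    by (rule carre(2)) (rule gen gen2 hh deriv cont that | assumption)+
  have X: "rc_process ?X"
    using assms(1) by (intro rc_process_shifted_integral U c) simp
  have contg: "continuous_on {0..T} (g x)" for x
    by (rule DERIV_continuous_on[where D = "g' x"])
      (auto intro: has_field_derivative_subset[OF deriv])
  have rc1: "rc_process (\<lambda>t \<omega>. \<Sum>x\<in>A. g' x t * apply_bcontfun (h x) (\<eta> t \<omega>))"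
    and rc2: "rc_process (\<lambda>t \<omega>. \<Sum>x\<in>A. g x t * apply_bcontfun (k x) (\<eta> t \<omega>))"
    by (intro rc_process_sum rc_process_mult rc_process_deterministic rc_process_bcontfun contg cont)+
  have dynkin: "?X t \<omega> = dynkin_mart l \<gamma> \<alpha> \<beta> n \<eta> G t \<omega>" if t: "t \<in> {0..T}" and \<omega>: "\<omega> \<in> space M" for t \<omega>
  proof -
    \<comment> \<open>\<open>dynkin_mart\<close> has separate integrals for the time derivative and
      for the generator, whereas \<open>c\<close> combines them; both parts are integrable along
      each path, so the integral may be split.\<close>
    have "(LBINT s:{0..t}. c s \<omega>) = (LBINT s:{0..t}. (\<Sum>x\<in>A. g' x s * apply_bcontfun (h x) (\<eta> s \<omega>)))
        + (LBINT s:{0..t}. (\<Sum>x\<in>A. g x s * apply_bcontfun (k x) (\<eta> s \<omega>)))"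
      unfolding c_def sum.distrib
      by (rule set_integral_add(2)[OF rc_path_integrable[OF rc1 t \<omega>] rc_path_integrable[OF rc2 t \<omega>]])
    also have "(LBINT s:{0..t}. (\<Sum>x\<in>A. g' x s * apply_bcontfun (h x) (\<eta> s \<omega>))) =
        (LBINT s:{0..t}. emp n (\<eta> s \<omega>) (time_deriv G s))"
      by (rule set_lebesgue_integral_cong) (auto simp: emp' h)
    also have "(LBINT s:{0..t}. (\<Sum>x\<in>A. g x s * apply_bcontfun (k x) (\<eta> s \<omega>))) =
        (LBINT s:{0..t}. time_scale \<gamma> n * excl_gen l \<gamma> \<alpha> \<beta> n (\<lambda>\<xi>. emp n \<xi> (G s)) (\<eta> s \<omega>))"
      by (rule set_lebesgue_integral_cong) (auto simp: Lemp)
    finally show ?thesis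
      using t by (simp add: dynkin_mart_def U_def emp h)
  qed
  have carre: "carre_du_champ_integral l \<gamma> \<alpha> \<beta> n \<eta> G t = (\<lambda>\<omega>. LBINT s:{0..t}. \<Gamma> s \<omega>)" for t
  proof
    fix \<omega>
    show "carre_du_champ_integral l \<gamma> \<alpha> \<beta> n \<eta> G t \<omega> = (LBINT s:{0..t}. \<Gamma> s \<omega>)"
      unfolding carre_du_champ_integral_def
    proof (rule set_lebesgue_integral_cong, simp, intro allI impI)
      fix s assume "s \<in> {0..t}"
      then have s: "s \<ge> 0" by simp
      show "time_scale \<gamma> n *
          (excl_gen l \<gamma> \<alpha> \<beta> n (\<lambda>\<xi>. (emp n \<xi> (G s))\<^sup>2) (\<eta> s \<omega>) -
           2 * emp n (\<eta> s \<omega>) (G s) * excl_gen l \<gamma> \<alpha> \<beta> n (\<lambda>\<xi>. emp n \<xi> (G s)) (\<eta> s \<omega>)) = \<Gamma> s \<omega>"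
        unfolding \<Gamma>_def Lemp2[OF s, symmetric] Lemp[OF s, symmetric] h emp[OF s, symmetric]
        by (simp add: right_diff_distrib)
    qed
  qed
  have "integrable M (\<lambda>\<omega>. (dynkin_mart l \<gamma> \<alpha> \<beta> n \<eta> G t \<omega>)\<^sup>2) \<and>
      integrable M (carre_du_champ_integral l \<gamma> \<alpha> \<beta> n \<eta> G t) \<and>
      (\<integral>\<omega>. (dynkin_mart l \<gamma> \<alpha> \<beta> n \<eta> G t \<omega>)\<^sup>2 \<partial>M) =
      (\<integral>\<omega>. carre_du_champ_integral l \<gamma> \<alpha> \<beta> n \<eta> G t \<omega> \<partial>M)" if t: "t \<in> {0..T}" for t
  proof (intro conjI)
    have "integrable M (\<lambda>\<omega>. (?X t \<omega>)\<^sup>2)"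
      unfolding power2_eq_square by (rule rc_integrable[OF rc_process_mult[OF X X] t])
    then show "integrable M (\<lambda>\<omega>. (dynkin_mart l \<gamma> \<alpha> \<beta> n \<eta> G t \<omega>)\<^sup>2)"
      by (rule Bochner_Integration.integrable_cong[THEN iffD1, OF refl, rotated]) (simp add: dynkin[OF t])
    show "integrable M (carre_du_champ_integral l \<gamma> \<alpha> \<beta> n \<eta> G t)"
      unfolding carre by (rule rc_integrable_path_integral[OF \<Gamma> t])
    have "(\<integral>\<omega>. (dynkin_mart l \<gamma> \<alpha> \<beta> n \<eta> G t \<omega>)\<^sup>2 \<partial>M) = (\<integral>\<omega>. (?X t \<omega>)\<^sup>2 \<partial>M)"
      by (rule Bochner_Integration.integral_cong) (simp_all add: dynkin[OF t])
    then show "(\<integral>\<omega>. (dynkin_mart l \<gamma> \<alpha> \<beta> n \<eta> G t \<omega>)\<^sup>2 \<partial>M) =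
        (\<integral>\<omega>. carre_du_champ_integral l \<gamma> \<alpha> \<beta> n \<eta> G t \<omega> \<partial>M)"
      unfolding carre second[OF t] .
  qed
  then show ?thesis
    using martingale_on_cong[OF mart dynkin] by blast
qed

end
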